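(* Let $n\in\{3,4\}$, let $X$ be a finite premaniplex of rank $n$ and let $G\le \mathrm{Aut}(X)$. Then there exist a finite maniplex $M$ of rank $n$ and a (colour-preserving) regular covering projection $\wp\colon M\to X$ such that $\mathrm{Aut}(M)$ is the lift of $G$ along $\wp$; that is, every element of $G$ lifts along $\wp$, and the group of all lifts of all elements of $G$ equals $\mathrm{Aut}(M)$.
   Context: Graphs: a graph is a $4$-tuple $(\mathrm D,\mathrm V;\mathrm{beg},\mathrm{inv})$ where $\mathrm D$ is a set of darts, $\mathrm V$ a non-empty set of vertices, $\mathrm{beg}:\mathrm D\to \mathrm V$ assigns to each dart its tail, and $\mathrm{inv}:\mathrm D\to\mathrm D$, $x\mapsto x^{-1}$, is an involution (possibly with fixed points). An edge is a pair $\{x,x^{-1}\}$; it is a semiedge if $x=x^{-1}$. The valency of a vertex is the number of darts with that tail. Multiple (parallel) edges are allowed. A graph is simple if it has no semiedges, no loops and no parallel edges. Homomorphisms, isomorphisms and automorphisms are maps on vertices and darts commuting with $\mathrm{beg}$ and $\mathrm{inv}$. Premaniplex of rank $n$: a connected graph whose edges and semiedges are coloured with colours $0,1,\dots,n-1$ so that every vertex is the tail of exactly one dart of each colour (the two darts of an edge having the colour of that edge; in particular there are no loops), and such that for all $i,j$ with $|i-j|\ge 2$ every walk of length $4$ whose colours alternate between $i$ and $j$ is closed. Maniplex of rank $n$: a connected simple $n$-valent graph whose edges are properly coloured with the colours $0,1,\dots,n-1$ and in which the edges of colours $i$ and $j$ form alternating $4$-cycles whenever $|i-j|\ge2$. Equivalently,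 a premaniplex of rank $n$ with no semiedges and no parallel edges. Automorphisms of (pre)maniplexes are colour-preserving graph automorphisms; $\mathrm{Aut}(\cdot)$ denotes the group of all of them. Covers: a covering projection $\wp:\tilde\Gamma\to\Gamma$ is a surjective graph homomorphism such that for every vertex $\tilde u$ of $\tilde\Gamma$, $\wp$ maps the darts with tail $\tilde u$ bijectively onto the darts with tail $\wp(\tilde u)$; for (pre)maniplexes $\wp$ is in addition required to preserve colours of darts. $\mathrm{CT}(\wp)$ is the group of automorphisms of $\tilde\Gamma$ preserving every fibre of $\wp$ setwise. The projection $\wp$ is regular if $\mathrm{CT}(\wp)$ acts regularly on each fibre. An automorphism $\alpha$ of $\Gamma$ lifts along $\wp$ if there is an automorphism $\tilde\alpha$ of $\tilde\Gamma$ (called a lift of $\alpha$) with $\wp\circ\tilde\alpha=\alpha\circ\wp$. If every element of $G\le\mathrm{Aut}(\Gamma)$ lifts along $\wp$, the set of all lifts of all elements of $G$ is a subgroup of $\mathrm{Aut}(\tilde\Gamma)$, called the lift of $G$. *)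

theory Defs
  imports "HOL-Algebra.Bij"
begin

section \<open>Graphs with darts\<close>

record ('v, 'd) dgraph =
  verts :: "'v set"
  darts :: "'d set"
  beg :: "'d \<Rightarrow> 'v"
  dinv :: "'d \<Rightarrow> 'd"

definition is_dgraph :: "('v, 'd, 'm) dgraph_scheme \<Rightarrow> bool" where
  "is_dgraph X \<longleftrightarrow> verts X \<noteq> {} \<and>
     (\<forall>x\<in>darts X. beg X x \<in> verts X \<and> dinv X x \<in> darts X \<and> dinv X (dinv X x) = x)"

definition finite_dgraph :: "('v, 'd, 'm) dgraph_scheme \<Rightarrow> bool" where
  "finite_dgraph X \<longleftrightarrow> finite (verts X) \<and> finite (darts X)"

definition darts_at :: "('v, 'd, 'm) dgraph_scheme \<Rightarrow> 'v \<Rightarrow> 'd set" where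
  "darts_at X v = {x \<in> darts X. beg X x = v}"

definition has_valency :: "('v, 'd, 'm) dgraph_scheme \<Rightarrow> nat \<Rightarrow> bool" where
  "has_valency X n \<longleftrightarrow> (\<forall>v\<in>verts X. finite (darts_at X v) \<and> card (darts_at X v) = n)"

definition edge_of :: "('v, 'd, 'm) dgraph_scheme \<Rightarrow> 'd \<Rightarrow> 'd set" where
  "edge_of X x = {x, dinv X x}"

definition no_semiedges :: "('v, 'd, 'm) dgraph_scheme \<Rightarrow> bool" where
  "no_semiedges X \<longleftrightarrow> (\<forall>x\<in>darts X. dinv X x \<noteq> x)"

definition no_loops :: "('v, 'd, 'm) dgraph_scheme \<Rightarrow> bool" where
  "no_loops X \<longleftrightarrow> (\<forall>x\<in>darts X. dinv X x \<noteq> x \<longrightarrow> beg X (dinv X x) \<noteq> beg X x)"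

definition no_parallel_edges :: "('v, 'd, 'm) dgraph_scheme \<Rightarrow> bool" where
  "no_parallel_edges X \<longleftrightarrow> (\<forall>x\<in>darts X. \<forall>y\<in>darts X.
     beg X ` edge_of X x = beg X ` edge_of X y \<longrightarrow> edge_of X x = edge_of X y)"

definition simple_dgraph :: "('v, 'd, 'm) dgraph_scheme \<Rightarrow> bool" where
  "simple_dgraph X \<longleftrightarrow> is_dgraph X \<and> no_semiedges X \<and> no_loops X \<and> no_parallel_edges X"

text \<open>\<open>walk X u xs v\<close>: the darts \<open>xs\<close>, traversed in this order, lead from \<open>u\<close> to \<open>v\<close>.
  The head of a dart is the tail of its inverse.\<close>

fun walk :: "('v, 'd, 'm) dgraph_scheme \<Rightarrow> 'v \<Rightarrow> 'd list \<Rightarrow> 'v \<Rightarrow> bool" where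
  "walk X u [] v \<longleftrightarrow> u \<in> verts X \<and> u = v"
| "walk X u (x # xs) v \<longleftrightarrow> x \<in> darts X \<and> beg X x = u \<and> walk X (beg X (dinv X x)) xs v"

definition connected_dgraph :: "('v, 'd, 'm) dgraph_scheme \<Rightarrow> bool" where
  "connected_dgraph X \<longleftrightarrow> is_dgraph X \<and> (\<forall>u\<in>verts X. \<forall>v\<in>verts X. \<exists>xs. walk X u xs v)"

section \<open>Premaniplexes and maniplexes\<close>

record ('v, 'd) cgraph = "('v, 'd) dgraph" +
  colour :: "'d \<Rightarrow> nat"

text \<open>Edge colourings are represented by dart colourings that agree on \<open>x\<close> and \<open>x\<^sup>-\<^sup>1\<close>.\<close>

definition edge_coloured :: "nat \<Rightarrow> ('v, 'd, 'm) cgraph_scheme \<Rightarrow> bool" where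
  "edge_coloured n X \<longleftrightarrow> (\<forall>x\<in>darts X. colour X x < n \<and> colour X (dinv X x) = colour X x)"

definition premaniplex :: "nat \<Rightarrow> ('v, 'd, 'm) cgraph_scheme \<Rightarrow> bool" where
  "premaniplex n X \<longleftrightarrow> connected_dgraph X \<and> edge_coloured n X \<and>
     (\<forall>v\<in>verts X. \<forall>i<n. \<exists>!x. x \<in> darts_at X v \<and> colour X x = i) \<and>
     (\<forall>i<n. \<forall>j<n. \<bar>int i - int j\<bar> \<ge> 2 \<longrightarrow>
        (\<forall>u v xs. walk X u xs v \<and> map (colour X) xs = [i, j, i, j] \<longrightarrow> u = v))"

text \<open>In a simple graph distinct darts with a common tail belong to distinct edges, so properness
  of the edge colouring is injectivity of \<open>colour\<close> on each \<open>darts_at X v\<close>. Properness also makes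
  the alternating 4-cycle through a vertex the whole component of that vertex in the subgraph
  formed by the edges of the two colours.\<close>

definition maniplex :: "nat \<Rightarrow> ('v, 'd, 'm) cgraph_scheme \<Rightarrow> bool" where
  "maniplex n X \<longleftrightarrow> connected_dgraph X \<and> simple_dgraph X \<and> has_valency X n \<and>
     edge_coloured n X \<and> (\<forall>v\<in>verts X. inj_on (colour X) (darts_at X v)) \<and>
     (\<forall>i<n. \<forall>j<n. \<bar>int i - int j\<bar> \<ge> 2 \<longrightarrow>
        (\<forall>u\<in>verts X. \<exists>xs. walk X u xs u \<and> map (colour X) xs = [i, j, i, j] \<and>
           distinct (map (beg X) xs)))"

section \<open>Homomorphisms and automorphisms\<close>

text \<open>A graph morphism is a pair consisting of a vertex map and a dart map.\<close>

definition dgraph_hom ::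
  "('v, 'd, 'm) dgraph_scheme \<Rightarrow> ('w, 'e, 'k) dgraph_scheme \<Rightarrow> (('v \<Rightarrow> 'w) \<times> ('d \<Rightarrow> 'e)) set" where
  "dgraph_hom X Y = {(f, g). f \<in> verts X \<rightarrow> verts Y \<and> g \<in> darts X \<rightarrow> darts Y \<and>
     (\<forall>x\<in>darts X. beg Y (g x) = f (beg X x) \<and> dinv Y (g x) = g (dinv X x))}"

definition colour_preserving ::
  "('v, 'd, 'm) cgraph_scheme \<Rightarrow> ('w, 'e, 'k) cgraph_scheme \<Rightarrow> ('v \<Rightarrow> 'w) \<times> ('d \<Rightarrow> 'e) \<Rightarrow> bool" where
  "colour_preserving X Y p \<longleftrightarrow> (\<forall>x\<in>darts X. colour Y (snd p x) = colour X x)"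

text \<open>As for \<^const>\<open>Bij\<close>, both components of an automorphism are extensional (equal to
  \<open>undefined\<close> outside the graph), so that equal automorphisms are equal as pairs of functions.\<close>

definition cgraph_auto ::
  "('v, 'd, 'm) cgraph_scheme \<Rightarrow> (('v \<Rightarrow> 'v) \<times> ('d \<Rightarrow> 'd)) set" where
  "cgraph_auto X = {a \<in> dgraph_hom X X. fst a \<in> Bij (verts X) \<and> snd a \<in> Bij (darts X) \<and>
     colour_preserving X X a}"

definition AutCGraph ::
  "('v, 'd, 'm) cgraph_scheme \<Rightarrow> (('v \<Rightarrow> 'v) \<times> ('d \<Rightarrow> 'd)) monoid" where
  "AutCGraph X = (BijGroup (verts X) \<times>\<times> BijGroup (darts X)) \<lparr>carrier := cgraph_auto X\<rparr>"

section \<open>Covering projections and lifts\<close>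

definition covering_projection ::
  "('w, 'e, 'k) cgraph_scheme \<Rightarrow> ('v, 'd, 'm) cgraph_scheme \<Rightarrow> ('w \<Rightarrow> 'v) \<times> ('e \<Rightarrow> 'd) \<Rightarrow> bool" where
  "covering_projection M X p \<longleftrightarrow> p \<in> dgraph_hom M X \<and> colour_preserving M X p \<and>
     fst p ` verts M = verts X \<and> snd p ` darts M = darts X \<and>
     (\<forall>u\<in>verts M. bij_betw (snd p) (darts_at M u) (darts_at X (fst p u)))"

definition vertex_fibre ::
  "('w, 'e, 'k) cgraph_scheme \<Rightarrow> ('w \<Rightarrow> 'v) \<times> ('e \<Rightarrow> 'd) \<Rightarrow> 'v \<Rightarrow> 'w set" where
  "vertex_fibre M p v = {u \<in> verts M. fst p u = v}"

definition dart_fibre ::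
  "('w, 'e, 'k) cgraph_scheme \<Rightarrow> ('w \<Rightarrow> 'v) \<times> ('e \<Rightarrow> 'd) \<Rightarrow> 'd \<Rightarrow> 'e set" where
  "dart_fibre M p x = {y \<in> darts M. snd p y = x}"

definition covering_transformations ::
  "('w, 'e, 'k) cgraph_scheme \<Rightarrow> ('v, 'd, 'm) cgraph_scheme \<Rightarrow> ('w \<Rightarrow> 'v) \<times> ('e \<Rightarrow> 'd) \<Rightarrow>
    (('w \<Rightarrow> 'w) \<times> ('e \<Rightarrow> 'e)) set" where
  "covering_transformations M X p = {a \<in> carrier (AutCGraph M).
     (\<forall>v\<in>verts X. fst a ` vertex_fibre M p v = vertex_fibre M p v) \<and>
     (\<forall>x\<in>darts X. snd a ` dart_fibre M p x = dart_fibre M p x)}"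

definition regular_covering_projection ::
  "('w, 'e, 'k) cgraph_scheme \<Rightarrow> ('v, 'd, 'm) cgraph_scheme \<Rightarrow> ('w \<Rightarrow> 'v) \<times> ('e \<Rightarrow> 'd) \<Rightarrow> bool" where
  "regular_covering_projection M X p \<longleftrightarrow> covering_projection M X p \<and>
     (\<forall>v\<in>verts X. \<forall>u\<in>vertex_fibre M p v. \<forall>u'\<in>vertex_fibre M p v.
        \<exists>!a. a \<in> covering_transformations M X p \<and> fst a u = u') \<and>
     (\<forall>x\<in>darts X. \<forall>y\<in>dart_fibre M p x. \<forall>y'\<in>dart_fibre M p x.
        \<exists>!a. a \<in> covering_transformations M X p \<and> snd a y = y')"

definition is_lift ::
  "('w, 'e, 'k) cgraph_scheme \<Rightarrow> ('w \<Rightarrow> 'v) \<times> ('e \<Rightarrow> 'd) \<Rightarrow>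
    ('v \<Rightarrow> 'v) \<times> ('d \<Rightarrow> 'd) \<Rightarrow> ('w \<Rightarrow> 'w) \<times> ('e \<Rightarrow> 'e) \<Rightarrow> bool" where
  "is_lift M p a b \<longleftrightarrow> b \<in> carrier (AutCGraph M) \<and>
     (\<forall>u\<in>verts M. fst p (fst b u) = fst a (fst p u)) \<and>
     (\<forall>y\<in>darts M. snd p (snd b y) = snd a (snd p y))"

definition lifts_along ::
  "('w, 'e, 'k) cgraph_scheme \<Rightarrow> ('w \<Rightarrow> 'v) \<times> ('e \<Rightarrow> 'd) \<Rightarrow> ('v \<Rightarrow> 'v) \<times> ('d \<Rightarrow> 'd) \<Rightarrow> bool" where
  "lifts_along M p a \<longleftrightarrow> (\<exists>b. is_lift M p a b)"

definition lift_of ::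
  "('w, 'e, 'k) cgraph_scheme \<Rightarrow> ('w \<Rightarrow> 'v) \<times> ('e \<Rightarrow> 'd) \<Rightarrow> (('v \<Rightarrow> 'v) \<times> ('d \<Rightarrow> 'd)) set \<Rightarrow>
    (('w \<Rightarrow> 'w) \<times> ('e \<Rightarrow> 'e)) set" where
  "lift_of M p G = {b. \<exists>a\<in>G. is_lift M p a b}"

section \<open>Consistency of the definitions\<close>

lemma AutCGraph_group:
  assumes "is_dgraph X"
  shows "group (AutCGraph X)"
proof -
  let ?B = "BijGroup (verts X) \<times>\<times> BijGroup (darts X)"
  interpret V: group "BijGroup (verts X)" by (rule group_BijGroup)
  interpret D: group "BijGroup (darts X)" by (rule group_BijGroup)
  interpret B: group ?B by (rule DirProd_group[OF V.is_group D.is_group])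
  have cl: "\<And>x. x \<in> darts X \<Longrightarrow> beg X x \<in> verts X \<and> dinv X x \<in> darts X"
    using assms by (auto simp: is_dgraph_def)
  have "subgroup (cgraph_auto X) ?B"
  proof (rule B.subgroupI)
    show "cgraph_auto X \<subseteq> carrier ?B"
      by (auto simp: cgraph_auto_def DirProd_def BijGroup_def)
    have "\<one>\<^bsub>?B\<^esub> \<in> cgraph_auto X"
      using cl by (auto simp: cgraph_auto_def DirProd_def BijGroup_def dgraph_hom_def
          colour_preserving_def id_Bij)
    then show "cgraph_auto X \<noteq> {}" by blast
  next
    fix a assume a: "a \<in> cgraph_auto X"
    obtain f g where fg: "a = (f, g)" by fastforce
    have fB: "f \<in> Bij (verts X)" and gB: "g \<in> Bij (darts X)"
      using a fg by (auto simp: cgraph_auto_def)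
    let ?f = "\<lambda>v\<in>verts X. inv_into (verts X) f v" and ?g = "\<lambda>x\<in>darts X. inv_into (darts X) g x"
    have i: "inv\<^bsub>?B\<^esub> a = (?f, ?g)"
      using fB gB by (simp add: fg inv_DirProd[OF V.is_group D.is_group] inv_BijGroup
          BijGroup_def[THEN arg_cong[where f=carrier]])
    have f: "bij_betw f (verts X) (verts X)" and g: "bij_betw g (darts X) (darts X)"
      using fB gB by (auto simp: Bij_def)
    have fi: "inv_into (verts X) f (f v) = v" if "v \<in> verts X" for v
      using f that by (simp add: bij_betw_inv_into_left)
    have gi: "inv_into (darts X) g (g x) = x" if "x \<in> darts X" for x
      using g that by (simp add: bij_betw_inv_into_left)
    have gm: "g x \<in> darts X" if "x \<in> darts X" for x using g that by (auto simp: bij_betw_def)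
    have "(?f, ?g) \<in> dgraph_hom X X \<and> colour_preserving X X (?f, ?g)"
    proof -
      have *: "beg X (?g y) = ?f (beg X y) \<and> dinv X (?g y) = ?g (dinv X y) \<and>
          colour X (?g y) = colour X y" if y: "y \<in> darts X" for y
      proof -
        obtain x where x: "x \<in> darts X" "y = g x" using g y by (auto simp: bij_betw_def)
        have h: "beg X (g x) = f (beg X x)" "dinv X (g x) = g (dinv X x)"
            "colour X (g x) = colour X x"
          using a x by (auto simp: fg cgraph_auto_def dgraph_hom_def colour_preserving_def)
        have "f (beg X x) \<in> verts X" using cl[OF gm[OF x(1)]] h by simp
        then show ?thesis using x h cl[OF x(1)] gm by (simp add: fi gi)
      qed
      moreover have "?f \<in> verts X \<rightarrow> verts X" "?g \<in> darts X \<rightarrow> darts X"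
        using f g by (auto simp: bij_betw_def inv_into_into)
      ultimately show ?thesis by (simp add: dgraph_hom_def colour_preserving_def)
    qed
    then show "inv\<^bsub>?B\<^esub> a \<in> cgraph_auto X"
      using fB gB by (simp add: i cgraph_auto_def restrict_inv_into_Bij)
  next
    fix a b assume ab: "a \<in> cgraph_auto X" "b \<in> cgraph_auto X"
    obtain f g f' g' where fg: "a = (f, g)" "b = (f', g')" by fastforce
    have B: "f \<in> Bij (verts X)" "f' \<in> Bij (verts X)" "g \<in> Bij (darts X)" "g' \<in> Bij (darts X)"
      using ab by (auto simp: fg cgraph_auto_def)
    have m: "a \<otimes>\<^bsub>?B\<^esub> b = (compose (verts X) f f', compose (darts X) g g')"
      using B by (simp add: fg DirProd_def BijGroup_def)
    show "a \<otimes>\<^bsub>?B\<^esub> b \<in> cgraph_auto X"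
      unfolding m using ab cl compose_Bij[OF B(1,2)] compose_Bij[OF B(3,4)]
      by (auto simp: fg cgraph_auto_def dgraph_hom_def colour_preserving_def compose_def Pi_iff)
  qed
  then show ?thesis unfolding AutCGraph_def by (rule B.subgroup_imp_group)
qed

lemma maniplex_iff_premaniplex:
  "maniplex n X \<longleftrightarrow> premaniplex n X \<and> no_semiedges X \<and> no_parallel_edges X"
proof
  assume M: "maniplex n X"
  have G: "is_dgraph X" using M by (simp add: maniplex_def connected_dgraph_def)
  have inj: "x = y" if "x \<in> darts X" "y \<in> darts X" "beg X x = beg X y" "colour X x = colour X y" for x y
    using M G that by (fastforce simp: maniplex_def darts_at_def is_dgraph_def inj_on_def)
  have im: "colour X ` darts_at X v = {..<n}" if v: "v \<in> verts X" for v
  proof (rule card_subset_eq)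
    show "colour X ` darts_at X v \<subseteq> {..<n}"
      using M by (auto simp: maniplex_def edge_coloured_def darts_at_def)
    show "card (colour X ` darts_at X v) = card {..<n}"
      using M v by (simp add: maniplex_def has_valency_def card_image)
  qed simp
  have ex: "\<exists>!x. x \<in> darts_at X v \<and> colour X x = i" if v: "v \<in> verts X" and i: "i < n" for v i
  proof -
    have "i \<in> colour X ` darts_at X v" using im[OF v] i by simp
    then obtain x where "x \<in> darts_at X v" "colour X x = i" by auto
    moreover have "y = x" if "y \<in> darts_at X v \<and> colour X y = i" for y
      using inj[of y x] that calculation by (simp add: darts_at_def)
    ultimately show ?thesis by blast
  qed
  have cyc: "\<exists>ys. walk X u ys u \<and> map (colour X) ys = [i, j, i, j] \<and> distinct (map (beg X) ys)"
    if "i < n" "j < n" "\<bar>int i - int j\<bar> \<ge> 2" "u \<in> verts X" for i j u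
  proof -
    have "\<forall>i<n. \<forall>j<n. \<bar>int i - int j\<bar> \<ge> 2 \<longrightarrow>
        (\<forall>u\<in>verts X. \<exists>xs. walk X u xs u \<and> map (colour X) xs = [i, j, i, j] \<and>
           distinct (map (beg X) xs))"
      using M unfolding maniplex_def by (elim conjE)
    then show ?thesis using that by blast
  qed
  have closed: "u = v" if ij: "i < n" "j < n" "\<bar>int i - int j\<bar> \<ge> 2" and w: "walk X u xs v"
    and c: "map (colour X) xs = [i, j, i, j]" for i j u v xs
  proof -
    obtain a1 a2 a3 a4 where a: "xs = [a1, a2, a3, a4]" using c by (auto simp: map_eq_Cons_conv)
    have u: "u \<in> verts X" using w G by (auto simp: a is_dgraph_def)
    obtain ys where ys: "walk X u ys u" "map (colour X) ys = [i, j, i, j]"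
      using cyc[OF ij u] by (elim exE conjE)
    obtain b1 b2 b3 b4 where b: "ys = [b1, b2, b3, b4]" using ys by (auto simp: map_eq_Cons_conv)
    have "a1 = b1" using w c ys by (intro inj) (auto simp: a b)
    moreover from this have "a2 = b2" using w c ys by (intro inj) (auto simp: a b)
    moreover from calculation have "a3 = b3" using w c ys by (intro inj) (auto simp: a b)
    moreover from calculation have "a4 = b4" using w c ys by (intro inj) (auto simp: a b)
    ultimately show ?thesis using w ys by (auto simp: a b)
  qed
  have "connected_dgraph X" "edge_coloured n X" "no_semiedges X" "no_parallel_edges X"
    using M by (simp_all add: maniplex_def simple_dgraph_def)
  moreover have "\<forall>v\<in>verts X. \<forall>i<n. \<exists>!x. x \<in> darts_at X v \<and> colour X x = i"
    using ex by (intro ballI allI impI)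
  moreover have "\<forall>i<n. \<forall>j<n. \<bar>int i - int j\<bar> \<ge> 2 \<longrightarrow>
        (\<forall>u v xs. walk X u xs v \<and> map (colour X) xs = [i, j, i, j] \<longrightarrow> u = v)"
    using closed by (intro allI impI; elim conjE)
  ultimately show "premaniplex n X \<and> no_semiedges X \<and> no_parallel_edges X"
    unfolding premaniplex_def by (intro conjI)
next
  assume P: "premaniplex n X \<and> no_semiedges X \<and> no_parallel_edges X"
  have G: "is_dgraph X" using P by (simp add: premaniplex_def connected_dgraph_def)
  then have Gx: "beg X x \<in> verts X" "dinv X x \<in> darts X" "dinv X (dinv X x) = x"
    if "x \<in> darts X" for x
    using that by (auto simp: is_dgraph_def)
  have col: "colour X x < n" "colour X (dinv X x) = colour X x" if "x \<in> darts X" for x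
    using P that by (auto simp: premaniplex_def edge_coloured_def)
  have ex: "\<exists>!x. x \<in> darts_at X v \<and> colour X x = i" if "v \<in> verts X" "i < n" for v i
    using P that unfolding premaniplex_def by blast
  have closed: "u = v" if "i < n" "j < n" "\<bar>int i - int j\<bar> \<ge> 2" "walk X u xs v"
    "map (colour X) xs = [i, j, i, j]" for i j u v xs
  proof -
    have "\<forall>i<n. \<forall>j<n. \<bar>int i - int j\<bar> \<ge> 2 \<longrightarrow>
        (\<forall>u v xs. walk X u xs v \<and> map (colour X) xs = [i, j, i, j] \<longrightarrow> u = v)"
      using P unfolding premaniplex_def by (elim conjE)
    from this[rule_format, OF that(1,2,3) conjI[OF that(4,5)]] show ?thesis .
  qed
  have inj: "x = y" if "x \<in> darts X" "y \<in> darts X" "beg X x = beg X y" "colour X x = colour X y" for x y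
    using ex[of "beg X x" "colour X x"] that Gx col by (auto simp: darts_at_def)
  have nl: "beg X (dinv X x) \<noteq> beg X x" if "x \<in> darts X" for x
    using inj[of "dinv X x" x] that P Gx col by (auto simp: no_semiedges_def)
  have par: "colour X x = colour X y" if "x \<in> darts X" "y \<in> darts X"
    "beg X (dinv X x) = beg X y" "beg X (dinv X y) = beg X x" for x y
  proof -
    have "edge_of X x = edge_of X y"
    proof -
      have "beg X ` edge_of X x = beg X ` edge_of X y"
        using that(3,4) by (simp add: edge_of_def insert_commute)
      then show ?thesis using P that(1,2) by (simp add: no_parallel_edges_def)
    qed
    then have "x = y \<or> x = dinv X y" by (auto simp: edge_of_def doubleton_eq_iff)
    then show ?thesis using col that(2) by auto
  qed
  have bij: "bij_betw (colour X) (darts_at X v) {..<n}" if v: "v \<in> verts X" for v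
    unfolding bij_betw_def
  proof
    show "inj_on (colour X) (darts_at X v)" by (intro inj_onI inj) (auto simp: darts_at_def)
    show "colour X ` darts_at X v = {..<n}"
    proof
      show "colour X ` darts_at X v \<subseteq> {..<n}" using col by (auto simp: darts_at_def)
      show "{..<n} \<subseteq> colour X ` darts_at X v"
        using ex[OF v] by (auto simp: image_iff) metis
    qed
  qed
  have val: "has_valency X n"
    unfolding has_valency_def using bij_betw_same_card[OF bij] bij_betw_finite[OF bij] by simp
  have cyc: "\<exists>xs. walk X u xs u \<and> map (colour X) xs = [i, j, i, j] \<and> distinct (map (beg X) xs)"
    if ij: "i < n" "j < n" "\<bar>int i - int j\<bar> \<ge> 2" and u: "u \<in> verts X" for i j u
  proof -
    have nxt: "\<exists>x\<in>darts X. beg X x = v \<and> colour X x = k" if "v \<in> verts X" "k < n" for v k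
      using ex[OF that] by (auto simp: darts_at_def)
    obtain a where a: "a \<in> darts X" "beg X a = u" "colour X a = i" using nxt u ij by blast
    obtain b where b: "b \<in> darts X" "beg X b = beg X (dinv X a)" "colour X b = j"
      using nxt[of "beg X (dinv X a)" j] Gx a ij by blast
    obtain c where c: "c \<in> darts X" "beg X c = beg X (dinv X b)" "colour X c = i"
      using nxt[of "beg X (dinv X b)" i] Gx b ij by blast
    obtain d where d: "d \<in> darts X" "beg X d = beg X (dinv X c)" "colour X d = j"
      using nxt[of "beg X (dinv X c)" j] Gx c ij by blast
    have w: "walk X u [a, b, c, d] (beg X (dinv X d))"
      using a b c d Gx by simp
    moreover have m: "map (colour X) [a, b, c, d] = [i, j, i, j]" using a b c d by simp
    ultimately have e: "beg X (dinv X d) = u" using closed[OF ij] by metis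
    have "i \<noteq> j" using ij by auto
    then have "beg X a \<noteq> beg X c" "beg X b \<noteq> beg X d"
      using par[of a b] par[of b c] a b c d by auto
    then have "distinct (map (beg X) [a, b, c, d])"
      using nl[of a] nl[of b] nl[of c] nl[of d] a b c d e by auto
    then show ?thesis using w m e by metis
  qed
  have "connected_dgraph X" "edge_coloured n X" using P by (simp_all add: premaniplex_def)
  moreover have "simple_dgraph X" using P G nl by (simp add: simple_dgraph_def no_loops_def)
  moreover have "\<forall>v\<in>verts X. inj_on (colour X) (darts_at X v)"
    using bij by (simp add: bij_betw_def)
  moreover have "\<forall>i<n. \<forall>j<n. \<bar>int i - int j\<bar> \<ge> 2 \<longrightarrow>
        (\<forall>u\<in>verts X. \<exists>xs. walk X u xs u \<and> map (colour X) xs = [i, j, i, j] \<and>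
           distinct (map (beg X) xs))"
    using cyc by (intro allI ballI impI)
  ultimately show "maniplex n X"
    unfolding maniplex_def using val by (intro conjI)
qed

end

(* A rank-n premaniplex is a finite transitive set V with involutions s_0, ..., s_{n-1} such that s_i
   and s_j commute for |i - j| >= 2. For a finite set Z with such an action and an equivariant map
   Z -> V, let the words in the s_i act on the preimage of the orbit G x0 and take the resulting
   maps as the vertices of M. The words fixing a vertex of M over x are those that act trivially on
   the preimage of the orbit G x, so the automorphisms of M are exactly the lifts of G, provided that
   these sets of words differ for different orbits. By conjugation, it suffices that some word moves
   only points of Z lying over a single point.

   Such a Z is obtained from V x D x D', where D and D' are regular dihedral sets that make the cycles
   of the two relevant colour pairs long and embedded, by placing two affine permutations alpha and
   beta of Z/5 on the edges of colours 1 and 2 near a base point c. Two closed words y1 and y2 pick up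
   the pair of holonomies (alpha, beta) only at c; elsewhere their holonomies commute or involve an
   inverse. As alpha and alpha^-1 have different linear parts, and likewise beta and beta^-1, a
   suitable word in y1 and y2 acts nontrivially over c only. *)

theory Submission
  imports Defs "HOL-Combinatorics.Cycles"
begin

section \<open>Actions of the colours\<close>

text \<open>In a connected graph with one dart of each colour at every vertex, some automorphism
  takes \<open>u\<close> to \<open>u'\<close> exactly if the same words close up at both. Hence
  automorphisms of M that do not project to X need no separate treatment: once the words closing at
  \<open>u\<close> determine the G-orbit of its image, every automorphism agrees at one vertex, and
  then everywhere, with a lift of an element of G.

  The obstacle to a word that moves points over one vertex only is that a mark on an edge is never
  seen from one place alone. Every point of an alternating cycle through the edge sees it, half of
  them in the inverse direction, and commuting colours copy it to the opposite edge of a 4-cycle.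
  Two marks on two cycles through a base point can, however, be arranged so that both are seen
  forwards from that point only. The commutator of the two maps registers that both marks are seen.
  The modulus 5 is the smallest one with a unit, 2, that differs from its inverse, and this is what
  makes the direction visible.\<close>

definition involutive_action :: "nat \<Rightarrow> 'a set \<Rightarrow> (nat \<Rightarrow> 'a \<Rightarrow> 'a) \<Rightarrow> bool" where
  "involutive_action n S s \<longleftrightarrow> (\<forall>i<n. \<forall>x\<in>S. s i x \<in> S \<and> s i (s i x) = x) \<and>
     (\<forall>i<n. \<forall>j<n. \<bar>int i - int j\<bar> \<ge> 2 \<longrightarrow> (\<forall>x\<in>S. s i (s j x) = s j (s i x)))"

definition wrds :: "nat \<Rightarrow> nat list set" where "wrds n = {w. set w \<subseteq> {..<n}}"

lemma wrds_simps [simp]: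
  "[] \<in> wrds n" "i # w \<in> wrds n \<longleftrightarrow> i < n \<and> w \<in> wrds n"
  "w @ w' \<in> wrds n \<longleftrightarrow> w \<in> wrds n \<and> w' \<in> wrds n" "rev w \<in> wrds n \<longleftrightarrow> w \<in> wrds n"
  by (auto simp: wrds_def)

definition transitive_action :: "nat \<Rightarrow> 'a set \<Rightarrow> (nat \<Rightarrow> 'a \<Rightarrow> 'a) \<Rightarrow> bool" where
  "transitive_action n S s \<longleftrightarrow> (\<forall>x\<in>S. \<forall>y\<in>S. \<exists>w\<in>wrds n. fold s w x = y)"

text \<open>The words labelling closed walks at \<open>x\<close>. They stand for a point stabiliser
  in the group generated by the colours, which is itself never formed.\<close>

definition word_stab :: "nat \<Rightarrow> (nat \<Rightarrow> 'a \<Rightarrow> 'a) \<Rightarrow> 'a \<Rightarrow> nat list set" where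
  "word_stab n s x = {w \<in> wrds n. fold s w x = x}"

lemma involutive_actionD:
  assumes "involutive_action n S s" "i < n" "x \<in> S"
  shows "s i x \<in> S" "s i (s i x) = x"
  using assms by (auto simp: involutive_action_def)

lemma involutive_action_commute:
  assumes "involutive_action n S s" "i < n" "j < n" "\<bar>int i - int j\<bar> \<ge> 2" "x \<in> S"
  shows "s i (s j x) = s j (s i x)"
  using assms unfolding involutive_action_def by blast

lemma fold_in:
  assumes "involutive_action n S s" "w \<in> wrds n" "x \<in> S"
  shows "fold s w x \<in> S"
  using assms(2,3) by (induction w arbitrary: x) (auto simp: involutive_actionD[OF assms(1)])

lemma fold_rev:
  assumes "involutive_action n S s" "w \<in> wrds n" "x \<in> S"
  shows "fold s (rev w) (fold s w x) = x" "fold s w (fold s (rev w) x) = x"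
proof -
  have *: "fold s (rev w) (fold s w x) = x" if "w \<in> wrds n" "x \<in> S" for w x
    using that by (induction w arbitrary: x) (auto simp: involutive_actionD[OF assms(1)])
  show "fold s (rev w) (fold s w x) = x" using * assms by blast
  show "fold s w (fold s (rev w) x) = x" using *[of "rev w" x] assms by simp
qed

lemma fold_inj:
  assumes "involutive_action n S s" "w \<in> wrds n" "x \<in> S" "y \<in> S" "fold s w x = fold s w y"
  shows "x = y"
  using fold_rev(1)[OF assms(1,2)] assms(3,4,5) by metis

lemma fold_equivariant:
  assumes "\<And>i x. i < n \<Longrightarrow> x \<in> S \<Longrightarrow> f (s i x) = t i (f x)"
    and "\<And>i x. i < n \<Longrightarrow> x \<in> S \<Longrightarrow> s i x \<in> S" and "w \<in> wrds n" "x \<in> S"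
  shows "f (fold s w x) = fold t w (f x)"
  using assms(3,4) by (induction w arbitrary: x) (auto simp: assms(1,2))

lemma transitive_actionI:
  assumes a: "involutive_action n S s" and x: "x \<in> S" and S: "\<And>y. y \<in> S \<Longrightarrow> \<exists>w\<in>wrds n. fold s w x = y"
  shows "transitive_action n S s"
  unfolding transitive_action_def
proof (intro ballI)
  fix y z assume "y \<in> S" "z \<in> S"
  then obtain w v where w: "w \<in> wrds n" "fold s w x = y" and v: "v \<in> wrds n" "fold s v x = z"
    using S by meson
  have "fold s (rev w @ v) y = z" using fold_rev(1)[OF a w(1) x] w v by simp
  moreover have "rev w @ v \<in> wrds n" using w v by simp
  ultimately show "\<exists>w\<in>wrds n. fold s w y = z" by blast
qed

text \<open>A transitive action is determined by a point stabiliser: the map sends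
  \<open>fold s w u\<close> to \<open>fold s w u'\<close>.\<close>

lemma equivariant_bij_if_word_stab_eq:
  assumes a: "involutive_action n S s" and tr: "transitive_action n S s"
    and u: "u \<in> S" and u': "u' \<in> S" and st: "word_stab n s u = word_stab n s u'"
  obtains f where "bij_betw f S S" "f u = u'" "\<And>i x. i < n \<Longrightarrow> x \<in> S \<Longrightarrow> f (s i x) = s i (f x)"
proof -
  \<comment> \<open>Two words with the same endpoint differ by an element of the stabiliser, and
    that property transfers from \<open>x\<close> to \<open>y\<close>. Used from \<open>u\<close> to
    \<open>u'\<close> this is well-definedness, used from \<open>u'\<close> to \<open>u\<close> it
    is injectivity.\<close>
  have wd: "fold s w y = fold s w' y" if "w \<in> wrds n" "w' \<in> wrds n" "fold s w x = fold s w' x"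
      "word_stab n s x = word_stab n s y" "x \<in> S" "y \<in> S" for w w' x y
  proof -
    have "w @ rev w' \<in> word_stab n s x"
      using that(1,2,3) fold_rev(1)[OF a that(2,5)] by (simp add: word_stab_def)
    then have "w @ rev w' \<in> word_stab n s y" by (simp only: that(4))
    then have "fold s (rev w') (fold s w y) = y" by (simp add: word_stab_def)
    then show ?thesis using fold_rev(2)[OF a that(2) fold_in[OF a that(1,6)]] by simp
  qed
  define W where "W x = (SOME w. w \<in> wrds n \<and> fold s w u = x)" for x
  have W: "W x \<in> wrds n" "fold s (W x) u = x" if "x \<in> S" for x
  proof -
    have "\<exists>w. w \<in> wrds n \<and> fold s w u = x" using tr u that unfolding transitive_action_def by blast
    from someI_ex[OF this] show "W x \<in> wrds n" "fold s (W x) u = x" by (auto simp: W_def)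
  qed
  define f where "f x = fold s (W x) u'" for x
  have f: "f (fold s w u) = fold s w u'" if "w \<in> wrds n" for w
    unfolding f_def using wd[OF _ that _ st u u'] W[OF fold_in[OF a that u]] by simp
  have "inj_on f S"
  proof (rule inj_onI)
    fix x y assume xy: "x \<in> S" "y \<in> S" "f x = f y"
    show "x = y"
      using wd[OF W(1)[OF xy(1)] W(1)[OF xy(2)] _ st[symmetric] u' u] xy W(2) by (simp add: f_def)
  qed
  moreover have "f ` S = S"
  proof
    show "f ` S \<subseteq> S" using W u' fold_in[OF a] by (auto simp: f_def)
    show "S \<subseteq> f ` S"
    proof
      fix x assume "x \<in> S"
      then obtain w where "w \<in> wrds n" "fold s w u' = x"
        using tr u' unfolding transitive_action_def by blast
      then show "x \<in> f ` S" using f fold_in[OF a _ u] by (metis imageI)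
    qed
  qed
  moreover have "f u = u'" using f[of "[]"] by simp
  moreover have "f (s i x) = s i (f x)" if "i < n" "x \<in> S" for i x
    using f[of "W x @ [i]"] f[of "W x"] W[OF that(2)] that by simp
  ultimately show thesis using that by (simp add: bij_betw_def)
qed

lemma word_stab_equivariant:
  assumes a: "involutive_action n S s" and f: "inj_on f S" "\<And>x. x \<in> S \<Longrightarrow> f x \<in> S"
      "\<And>i x. i < n \<Longrightarrow> x \<in> S \<Longrightarrow> f (s i x) = s i (f x)" and u: "u \<in> S"
  shows "word_stab n s (f u) = word_stab n s u"
proof -
  have "fold s w (f u) = f (fold s w u)" if "w \<in> wrds n" for w
    using fold_equivariant[of n S f s s, OF f(3) involutive_actionD(1)[OF a] that u] by simp
  then have "fold s w (f u) = f u \<longleftrightarrow> fold s w u = u" if "w \<in> wrds n" for w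
    using that inj_on_eq_iff[OF f(1) fold_in[OF a that u] u] by simp
  then show ?thesis unfolding word_stab_def by blast
qed

text \<open>If some word moves points of the fibre over a single point only, then its conjugates tell
  the classes of an invariant equivalence relation apart.\<close>

lemma separating_action:
  fixes s :: "nat \<Rightarrow> 'v \<Rightarrow> 'v" and sZ :: "nat \<Rightarrow> 'z \<Rightarrow> 'z"
  assumes V: "involutive_action n V s" "transitive_action n V s" and fV: "finite V"
    and Z: "involutive_action n Z sZ" "finite Z"
    and \<rho>: "\<And>z. z \<in> Z \<Longrightarrow> \<rho> z \<in> V" "\<And>i z. i < n \<Longrightarrow> z \<in> Z \<Longrightarrow> \<rho> (sZ i z) = s i (\<rho> z)"
    and fp: "\<And>i z. i < n \<Longrightarrow> z \<in> Z \<Longrightarrow> sZ i z \<noteq> z"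
    and ds: "\<And>i j z. i < n \<Longrightarrow> j < n \<Longrightarrow> i \<noteq> j \<Longrightarrow> z \<in> Z \<Longrightarrow> sZ i z \<noteq> sZ j z"
    and y: "y \<in> wrds n" "c \<in> Z" "fold sZ y c \<noteq> c"
      "\<And>z. z \<in> Z \<Longrightarrow> fold sZ y z \<noteq> z \<Longrightarrow> \<rho> z = \<rho> c"
    and E: "equiv V E" "\<And>i x x'. i < n \<Longrightarrow> (x, x') \<in> E \<Longrightarrow> (s i x, s i x') \<in> E"
  obtains U :: "('v \<times> 'z list) set" and t where "finite U" "U \<noteq> {}" "involutive_action n U t"
    "transitive_action n U t"
    "\<And>u. u \<in> U \<Longrightarrow> fst u \<in> V" "\<And>i u. i < n \<Longrightarrow> u \<in> U \<Longrightarrow> fst (t i u) = s i (fst u)"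
    "\<And>i u. i < n \<Longrightarrow> u \<in> U \<Longrightarrow> t i u \<noteq> u"
    "\<And>i j u. i < n \<Longrightarrow> j < n \<Longrightarrow> i \<noteq> j \<Longrightarrow> u \<in> U \<Longrightarrow> t i u \<noteq> t j u"
    "\<And>u u'. u \<in> U \<Longrightarrow> u' \<in> U \<Longrightarrow> word_stab n t u = word_stab n t u' \<longleftrightarrow> (fst u, fst u') \<in> E"
proof -
  let ?x = "\<rho> c"
  have x: "?x \<in> V" using \<rho> y by blast
  have Er: "(x, x) \<in> E" if "x \<in> V" for x using E(1) that by (simp add: equiv_def refl_on_def)
  have Es: "(x', x) \<in> E" if "(x, x') \<in> E" for x x' using E(1) that by (simp add: equiv_def sym_def)
  have Et: "(x, x'') \<in> E" if "(x, x') \<in> E" "(x', x'') \<in> E" for x x' x''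
    using E(1) that unfolding equiv_def by (blast dest: transD)
  have Ef: "(fold s w x, fold s w x') \<in> E" if "w \<in> wrds n" "(x, x') \<in> E" for w x x'
    using that by (induction w arbitrary: x x') (auto simp: E(2))
  have \<rho>f: "\<rho> (fold sZ w z) = fold s w (\<rho> z)" if "w \<in> wrds n" "z \<in> Z" for w z
    using fold_equivariant[of n Z \<rho> sZ s] \<rho>(2) involutive_actionD(1)[OF Z(1)] that by blast
  have "finite {z \<in> Z. (?x, \<rho> z) \<in> E}" using Z(2) by simp
  then obtain zs where zs: "set zs = {z \<in> Z. (?x, \<rho> z) \<in> E}" using finite_list by metis
  \<comment> \<open>A vertex of the cover records what a word does to the points over the class of
    \<open>?x\<close>, as the list of images of the enumeration \<open>zs\<close>; the first
    component is the image of \<open>?x\<close> in \<open>V\<close>. Lists of fixed length over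
    \<open>Z\<close> make \<open>U\<close> finite although there are infinitely many words.\<close>
  define t :: "nat \<Rightarrow> 'v \<times> 'z list \<Rightarrow> 'v \<times> 'z list" where "t i u = (s i (fst u), map (sZ i) (snd u))" for i u
  define U where "U = (\<lambda>w. (fold s w ?x, map (fold sZ w) zs)) ` wrds n"
  have ft: "fold t w u = (fold s w (fst u), map (fold sZ w) (snd u))" for w u
    by (induction w arbitrary: u) (auto simp: t_def)
  have Ui: "fold t w (?x, zs) \<in> U" if "w \<in> wrds n" for w using that by (auto simp: U_def ft)
  have Ue: "\<exists>w\<in>wrds n. u = fold t w (?x, zs)" if "u \<in> U" for u using that by (auto simp: U_def ft)
  \<comment> \<open>The list at \<open>u\<close> runs through exactly the points over the class of
    \<open>fst u\<close>: invariance of \<open>E\<close> under words gives one inclusion, the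
    reversed word the other.\<close>
  have sU: "set (snd u) = {z \<in> Z. (fst u, \<rho> z) \<in> E}" and fU: "fst u \<in> V"
    and lU: "length (snd u) = length zs" if "u \<in> U" for u
  proof -
    obtain w where w0: "w \<in> wrds n" "u = fold t w (?x, zs)"
      using Ue[OF \<open>u \<in> U\<close>] by (elim bexE)
    then have w: "w \<in> wrds n" "u = (fold s w ?x, map (fold sZ w) zs)" by (simp_all add: ft)
    have r: "rev w \<in> wrds n" using w by simp
    show "fst u \<in> V" using w fold_in[OF V(1) _ x] by simp
    show "length (snd u) = length zs" using w by simp
    have "z \<in> fold sZ w ` {z \<in> Z. (?x, \<rho> z) \<in> E}" if z: "z \<in> Z" "(fold s w ?x, \<rho> z) \<in> E" for z
    proof -
      have "(fold s (rev w) (fold s w ?x), fold s (rev w) (\<rho> z)) \<in> E" by (rule Ef[OF r z(2)])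
      then have "(?x, \<rho> (fold sZ (rev w) z)) \<in> E"
        using fold_rev(1)[OF V(1) w(1) x] \<rho>f[OF r z(1)] by simp
      then show ?thesis using fold_rev(2)[OF Z(1) w(1) z(1)] fold_in[OF Z(1) r z(1)]
        by (metis (mono_tags, lifting) imageI mem_Collect_eq)
    qed
    then show "set (snd u) = {z \<in> Z. (fst u, \<rho> z) \<in> E}"
      using w Ef fold_in[OF Z(1) w(1)] by (auto simp: zs \<rho>f[OF w(1)])
  qed
  have tU: "t i u \<in> U" if "i < n" "u \<in> U" for i u
  proof -
    from Ue[OF that(2)] obtain w where w: "w \<in> wrds n" "u = fold t w (?x, zs)" by blast
    have "t i u = fold t (w @ [i]) (?x, zs)" using w by simp
    moreover have "w @ [i] \<in> wrds n" using w(1) that(1) by simp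
    ultimately show ?thesis using Ui by presburger
  qed
  have Z0: "z \<in> Z" if "z \<in> set (snd u)" "u \<in> U" for z u using that sU by blast
  have iU: "involutive_action n U t"
    unfolding involutive_action_def
  proof (intro conjI allI impI ballI)
    fix i u assume i: "i < n" and u: "u \<in> U"
    show "t i u \<in> U" by (rule tU[OF i u])
    show "t i (t i u) = u" using involutive_actionD(2)[OF V(1) i fU[OF u]]
        involutive_actionD(2)[OF Z(1) i Z0[OF _ u]] by (simp add: t_def prod_eq_iff o_def map_idI)
  next
    fix i j u assume i: "i < n" "j < n" "\<bar>int i - int j\<bar> \<ge> 2" and u: "u \<in> U"
    show "t i (t j u) = t j (t i u)" using involutive_action_commute[OF V(1) i fU[OF u]]
        involutive_action_commute[OF Z(1) i Z0[OF _ u]] by (simp add: t_def)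
  qed
  have surj: "\<exists>z\<in>Z. \<rho> z = v" if "v \<in> V" for v
  proof -
    from V(2) x that obtain w where "w \<in> wrds n" "fold s w ?x = v"
      unfolding transitive_action_def by blast
    then show ?thesis using \<rho>f[OF _ y(2)] fold_in[OF Z(1) _ y(2)] by blast
  qed
  have ex: "\<exists>z\<in>set (snd u). \<rho> z = fst u" if "u \<in> U" for u
    using surj[OF fU[OF that]] sU[OF that] Er[OF fU[OF that]] by auto
  \<comment> \<open>The stabiliser depends on \<open>fst u\<close> only through its class. That a
    word fixing the list also fixes \<open>fst u\<close> is automatic, since the list contains a
    point over \<open>fst u\<close>.\<close>
  have st: "word_stab n t u = {w \<in> wrds n. \<forall>z\<in>Z. (fst u, \<rho> z) \<in> E \<longrightarrow> fold sZ w z = z}" (is "_ = ?R")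
    if u: "u \<in> U" for u
  proof (intro Set.set_eqI iffI)
    fix w assume "w \<in> word_stab n t u"
    then have w: "w \<in> wrds n" "map (fold sZ w) (snd u) = snd u"
      by (auto simp: word_stab_def ft prod_eq_iff)
    have "fold sZ w z = z" if "z \<in> set (snd u)" for z
      using w(2) that by (metis map_eq_conv map_ident)
    then show "w \<in> ?R" using sU[OF u] w(1) by auto
  next
    fix w assume "w \<in> ?R"
    then have w: "w \<in> wrds n" "\<And>z. z \<in> set (snd u) \<Longrightarrow> fold sZ w z = z" using sU[OF u] by auto
    obtain z where z: "z \<in> set (snd u)" "\<rho> z = fst u" using ex[OF u] by blast
    have "fold s w (fst u) = fst u" using \<rho>f[OF w(1) Z0[OF z(1) u]] w(2)[OF z(1)] z(2) by simp
    then show "w \<in> word_stab n t u" using w by (simp add: word_stab_def ft prod_eq_iff map_idI)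
  qed
  show thesis
  proof (rule that)
    show "finite U"
    proof (rule finite_subset)
      show "U \<subseteq> V \<times> {l. set l \<subseteq> Z \<and> length l = length zs}" using fU sU lU by fastforce
      show "finite (V \<times> {l. set l \<subseteq> Z \<and> length l = length zs})"
        using fV Z(2) finite_lists_length_eq by auto
    qed
    show "U \<noteq> {}" using Ui[of "[]"] by auto
    show "involutive_action n U t" by (rule iU)
    show "transitive_action n U t"
      using transitive_actionI[OF iU, of "(?x, zs)"] Ui[of "[]"] Ue by fastforce
    show "fst u \<in> V" if "u \<in> U" for u by (rule fU[OF that])
    show "fst (t i u) = s i (fst u)" for i u by (simp add: t_def)
    show "t i u \<noteq> u" if i: "i < n" and u: "u \<in> U" for i u
    proof
      obtain z where z: "z \<in> set (snd u)" using ex[OF u] by blast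
      assume "t i u = u"
      then have "map (sZ i) (snd u) = snd u" by (simp add: t_def prod_eq_iff)
      then have "sZ i z = z" using z by (metis map_eq_conv map_ident)
      then show False using fp[OF i Z0[OF z u]] by simp
    qed
    show "t i u \<noteq> t j u" if i: "i < n" "j < n" "i \<noteq> j" and u: "u \<in> U" for i j u
    proof
      obtain z where z: "z \<in> set (snd u)" using ex[OF u] by blast
      assume "t i u = t j u"
      then have "sZ i z = sZ j z" using z by (simp add: t_def)
      then show False using ds[OF i Z0[OF z u]] by simp
    qed
    show "word_stab n t u = word_stab n t u' \<longleftrightarrow> (fst u, fst u') \<in> E" if u: "u \<in> U" "u' \<in> U" for u u'
    proof
      assume "(fst u, fst u') \<in> E"
      then show "word_stab n t u = word_stab n t u'" unfolding st[OF u(1)] st[OF u(2)] using Es Et by blast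
    next
      assume eq: "word_stab n t u = word_stab n t u'"
      show "(fst u, fst u') \<in> E"
      proof (rule ccontr)
        assume nE: "(fst u, fst u') \<notin> E"
        obtain w where w: "w \<in> wrds n" "fold s w (fst u') = ?x"
          using V(2) x fU[OF u(2)] unfolding transitive_action_def by blast
        have r: "rev w \<in> wrds n" using w by simp
        \<comment> \<open>Words act from left to right: \<open>?v\<close> carries the fibre over
          \<open>fst u'\<close> to the one over \<open>?x\<close>, applies \<open>y\<close> there
          and returns. So it moves points over \<open>fst u'\<close> only, which leaves the points
          over the class of \<open>fst u\<close> fixed, but it does move the image of
          \<open>c\<close> under \<open>rev w\<close>.\<close>
        let ?v = "w @ y @ rev w"
        have v: "?v \<in> wrds n" using w(1) y(1) r by simp
        have "fold sZ ?v z = z" if z: "z \<in> Z" "(fst u, \<rho> z) \<in> E" for z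
        proof -
          have "fold sZ y (fold sZ w z) = fold sZ w z"
          proof (rule ccontr)
            assume "\<not> ?thesis"
            then have "\<rho> (fold sZ w z) = ?x" using y(4) fold_in[OF Z(1) w(1) z(1)] by blast
            then have "fold s w (\<rho> z) = fold s w (fst u')" using \<rho>f[OF w(1) z(1)] w(2) by simp
            then have "\<rho> z = fst u'" using fold_inj[OF V(1) w(1) \<rho>(1)[OF z(1)] fU[OF u(2)]] by simp
            then show False using z(2) nE by simp
          qed
          then show ?thesis using fold_rev(1)[OF Z(1) w(1) z(1)] by simp
        qed
        then have "?v \<in> word_stab n t u'" unfolding eq[symmetric] st[OF u(1)] using v by blast
        then have fix_v: "fold sZ ?v z = z" if "z \<in> Z" "(fst u', \<rho> z) \<in> E" for z
          using that st[OF u(2)] by blast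
        let ?z = "fold sZ (rev w) c"
        have z: "?z \<in> Z" by (rule fold_in[OF Z(1) r y(2)])
        have "\<rho> ?z = fst u'" using \<rho>f[OF r y(2)] w fold_rev(1)[OF V(1) w(1) fU[OF u(2)]] by simp
        then have "fold sZ ?v ?z = ?z" using fix_v[OF z] Er[OF fU[OF u(2)]] by simp
        then have "fold sZ (rev w) (fold sZ y c) = fold sZ (rev w) c"
          using fold_rev(2)[OF Z(1) w(1) y(2)] by simp
        then show False using fold_inj[OF Z(1) r fold_in[OF Z(1) y(1,2)] y(2)] y(3) by blast
      qed
    qed
  qed
qed

section \<open>Affine holonomy\<close>

text \<open>A pair \<open>(u, v)\<close> encodes the map \<open>t \<mapsto> u t + v\<close> of the residues modulo 5.\<close>

definition aff :: "nat \<times> nat \<Rightarrow> nat \<Rightarrow> nat" where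
  "aff F t = (fst F * t + snd F) mod 5"

definition aff_comp :: "nat \<times> nat \<Rightarrow> nat \<times> nat \<Rightarrow> nat \<times> nat" where
  "aff_comp F G = ((fst F * fst G) mod 5, (fst F * snd G + snd F) mod 5)"

lemma aff_less [simp]: "aff F t < 5"
  by (simp add: aff_def)

lemma aff_one: "t < 5 \<Longrightarrow> aff (1, 0) t = t"
  by (simp add: aff_def)

lemma aff_comp: "aff (aff_comp F G) t = aff F (aff G t)"
proof -
  have l: "(a mod 5 * t + b mod 5) mod 5 = (a * t + b) mod 5" for a b t :: nat
    by (rule mod_add_cong; (rule mod_mult_cong)?; rule mod_mod_trivial refl)
  have r: "(a * (b mod 5) + c) mod 5 = (a * b + c) mod 5" for a b c :: nat
    by (rule mod_add_cong; (rule mod_mult_cong)?; rule mod_mod_trivial refl)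
  show ?thesis
    unfolding aff_def aff_comp_def fst_conv snd_conv l r by (simp add: algebra_simps)
qed

section \<open>Words that recognise a pair of affine maps\<close>

definition word_comm :: "nat list \<Rightarrow> nat list \<Rightarrow> nat list" where
  "word_comm a b = a @ b @ rev a @ rev b"

text \<open>Conjugation by \<open>a\<close> multiplies a translation \<open>x\<close> by the linear part of \<open>a\<close>, so the following
  word is trivial if and only if that linear part is \<open>-2 = 3\<close> modulo \<open>5\<close>: the one of \<open>\<alpha>\<^sup>-\<^sup>1\<close> and
  \<open>\<beta>\<^sup>-\<^sup>1\<close>, whereas \<open>\<alpha>\<close> and \<open>\<beta>\<close> have linear part \<open>2\<close>.\<close>

definition word_kill :: "nat list \<Rightarrow> nat list \<Rightarrow> nat list" where
  "word_kill a x = rev a @ x @ a @ x @ x"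

definition word_isolate :: "nat list \<Rightarrow> nat list \<Rightarrow> nat list" where
  "word_isolate a b = word_kill b (word_kill a (word_comm a b))"

text \<open>Inverse maps are carried along as second components, so that words can be reversed.\<close>

definition holonomy :: "(nat \<Rightarrow> 'p \<times> nat \<Rightarrow> 'p \<times> nat) \<Rightarrow> 'p \<Rightarrow> nat list \<Rightarrow> (nat \<times> nat) \<times> (nat \<times> nat) \<Rightarrow> bool" where
  "holonomy sZ p w H \<longleftrightarrow> (\<forall>t<5. fold sZ w (p, t) = (p, aff (fst H) t) \<and>
     fold sZ (rev w) (p, t) = (p, aff (snd H) t))"

text \<open>\<open>fold\<close> reads a word from the left, so the map of the later word stands
  outside; the inverse components compose in the opposite order.\<close>

definition hol_mult where
  "hol_mult H K = (aff_comp (fst K) (fst H), aff_comp (snd H) (snd K))"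

lemma holonomy_append: "holonomy sZ p w H \<Longrightarrow> holonomy sZ p w' K \<Longrightarrow> holonomy sZ p (w @ w') (hol_mult H K)"
  by (simp add: holonomy_def hol_mult_def aff_comp)

lemma holonomy_rev: "holonomy sZ p w H \<Longrightarrow> holonomy sZ p (rev w) (prod.swap H)"
  by (simp add: holonomy_def)

definition hol_comm where
  "hol_comm A B = hol_mult A (hol_mult B (hol_mult (prod.swap A) (prod.swap B)))"

definition hol_kill where
  "hol_kill A x = hol_mult (prod.swap A) (hol_mult x (hol_mult A (hol_mult x x)))"

definition hol_isolate where
  "hol_isolate A B = hol_kill B (hol_kill A (hol_comm A B))"

lemma holonomy_isolate:
  "holonomy sZ p a A \<Longrightarrow> holonomy sZ p b B \<Longrightarrow> holonomy sZ p (word_isolate a b) (hol_isolate A B)"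
  unfolding word_isolate_def word_kill_def word_comm_def hol_isolate_def hol_kill_def hol_comm_def
  by (intro holonomy_append holonomy_rev)

lemma holonomyI:
  assumes a: "involutive_action n (P \<times> {..<5::nat}) sZ" and w: "w \<in> wrds n" and p: "p \<in> P"
    and F: "\<And>t. t < 5 \<Longrightarrow> fold sZ w (p, t) = (p, aff F t)"
    and inv: "\<And>t. t < 5 \<Longrightarrow> aff F (aff G t) = t"
  shows "holonomy sZ p w (F, G)"
  unfolding holonomy_def
proof (intro allI impI conjI)
  fix t :: nat assume t: "t < 5"
  show "fold sZ w (p, t) = (p, aff (fst (F, G)) t)" using F t by simp
  have "fold sZ w (p, aff G t) = (p, t)" using F[of "aff G t"] inv[OF t] by simp
  then show "fold sZ (rev w) (p, t) = (p, aff (snd (F, G)) t)"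
    using fold_rev(1)[OF a w, of "(p, aff G t)"] p by simp
qed

text \<open>The linear parts 2 and 3 are inverse to each other modulo 5. \<open>hol\<alpha>\<close>
  and \<open>hol\<beta>\<close> share the linear part 2 but fix the residues 0 and 4, so they do not
  commute. The second components are the inverse maps.\<close>

definition hol1 :: "(nat \<times> nat) \<times> (nat \<times> nat)" where "hol1 = ((1, 0), (1, 0))"
definition hol\<alpha> :: "(nat \<times> nat) \<times> (nat \<times> nat)" where "hol\<alpha> = ((2, 0), (3, 0))"
definition hol\<beta> :: "(nat \<times> nat) \<times> (nat \<times> nat)" where "hol\<beta> = ((2, 1), (3, 2))"

lemma hol_mult_Pair: "hol_mult ((a, b), (c, d)) ((a', b'), (c', d')) =
    (((a' * a) mod 5, (a' * b + b') mod 5), ((c * c') mod 5, (c * d' + d) mod 5))"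
  by (simp add: hol_mult_def aff_comp_def)

lemma hol_kill_Pair: "hol_kill ((a, b), (c, d)) ((a', b'), (c', d')) =
    hol_mult ((c, d), (a, b)) (hol_mult ((a', b'), (c', d')) (hol_mult ((a, b), (c, d))
      (hol_mult ((a', b'), (c', d')) ((a', b'), (c', d')))))"
  by (simp add: hol_kill_def)

text \<open>If one map is trivial or both are powers of \<open>hol\<alpha>\<close>, the commutator
  vanishes already. Otherwise it is a translation and at least one of the two maps is an inverse,
  with linear part 3, so the \<open>hol_kill\<close> for that map annihilates it.\<close>

lemma hol_isolate_trivial:
  assumes "A \<in> {hol1, hol\<alpha>, prod.swap hol\<alpha>}"
    and "B \<in> {hol1, hol\<alpha>, prod.swap hol\<alpha>, hol\<beta>, prod.swap hol\<beta>}"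
    and "\<not> (A = hol\<alpha> \<and> B = hol\<beta>)"
  shows "hol_isolate A B = hol1"
  using assms by (elim insertE emptyE)
    (simp_all add: hol_isolate_def hol_comm_def hol1_def hol\<alpha>_def hol\<beta>_def hol_mult_Pair hol_kill_Pair)

text \<open>Different fixed points make the commutator a non-zero translation, and each
  \<open>hol_kill\<close> multiplies it by 2 + 2 = 4, a unit modulo 5.\<close>

lemma hol_isolate_nontrivial: "aff (fst (hol_isolate hol\<alpha> hol\<beta>)) 0 \<noteq> 0"
  by (simp add: hol_isolate_def hol_comm_def hol\<alpha>_def hol\<beta>_def hol_mult_Pair hol_kill_Pair aff_def)

lemma word_isolate_moves_only:
  assumes "holonomy sZ c y1 hol\<alpha>" "holonomy sZ c y2 hol\<beta>"
    and "\<And>p. p \<in> P \<Longrightarrow> \<exists>A B. A \<in> {hol1, hol\<alpha>, prod.swap hol\<alpha>} \<and>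
      B \<in> {hol1, hol\<alpha>, prod.swap hol\<alpha>, hol\<beta>, prod.swap hol\<beta>} \<and>
      holonomy sZ p y1 A \<and> holonomy sZ p y2 B \<and> (A = hol\<alpha> \<longrightarrow> B = hol\<beta> \<longrightarrow> p = c)"
  shows "fold sZ (word_isolate y1 y2) (c, 0) \<noteq> (c, 0)"
    and "\<And>z. z \<in> P \<times> {..<5} \<Longrightarrow> fold sZ (word_isolate y1 y2) z \<noteq> z \<Longrightarrow> fst z = c"
proof -
  show "fold sZ (word_isolate y1 y2) (c, 0) \<noteq> (c, 0)"
    using holonomy_isolate[OF assms(1,2)] hol_isolate_nontrivial by (simp add: holonomy_def)
  fix z assume z: "z \<in> P \<times> {..<5}" and m: "fold sZ (word_isolate y1 y2) z \<noteq> z"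
  obtain p t where pt: "z = (p, t)" "p \<in> P" "t < 5" using z by auto
  obtain A B where AB: "A \<in> {hol1, hol\<alpha>, prod.swap hol\<alpha>}"
      "B \<in> {hol1, hol\<alpha>, prod.swap hol\<alpha>, hol\<beta>, prod.swap hol\<beta>}"
      "holonomy sZ p y1 A" "holonomy sZ p y2 B" "A = hol\<alpha> \<longrightarrow> B = hol\<beta> \<longrightarrow> p = c"
    using assms(3)[OF pt(2)] by blast
  show "fst z = c"
  proof (rule ccontr)
    assume "fst z \<noteq> c"
    then have "hol_isolate A B = hol1" using hol_isolate_trivial[OF AB(1,2)] AB(5) pt by auto
    then have "holonomy sZ p (word_isolate y1 y2) hol1" using holonomy_isolate[OF AB(3,4)] by simp
    then have "fold sZ (word_isolate y1 y2) (p, t) = (p, t)"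
      using pt(3) unfolding holonomy_def hol1_def by (metis aff_one fst_conv)
    then show False using m pt(1) by simp
  qed
qed

section \<open>Voltages on marked edges\<close>

definition volt :: "(nat \<Rightarrow> 'p \<Rightarrow> 'p) \<Rightarrow> (nat \<Rightarrow> 'p set) \<Rightarrow> nat \<Rightarrow> 'p \<Rightarrow> (nat \<times> nat) \<times> (nat \<times> nat)" where
  "volt s S i p = (let H = if i = 1 then hol\<alpha> else hol\<beta> in
     if p \<in> S i then H else if s i p \<in> S i then prod.swap H else hol1)"

text \<open>The permutation voltage cover with the residues modulo 5 as fibre. \<open>S i\<close>
  consists of the tails of the marked edges of colour \<open>i\<close>; read from its other end,
  such an edge carries the inverse map.\<close>

definition twist :: "(nat \<Rightarrow> 'p \<Rightarrow> 'p) \<Rightarrow> (nat \<Rightarrow> 'p set) \<Rightarrow> nat \<Rightarrow> 'p \<times> nat \<Rightarrow> 'p \<times> nat" where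
  "twist s S i z = (s i (fst z), aff (fst (volt s S i (fst z))) (snd z))"

lemma aff_inverse:
  assumes "H \<in> {hol1, hol\<alpha>, prod.swap hol\<alpha>, hol\<beta>, prod.swap hol\<beta>}" "t < 5"
  shows "aff (fst H) (aff (snd H) t) = t" "aff (snd H) (aff (fst H) t) = t"
proof -
  have "aff_comp (fst H) (snd H) = (1, 0)" "aff_comp (snd H) (fst H) = (1, 0)"
    using assms(1) by (auto simp: hol1_def hol\<alpha>_def hol\<beta>_def aff_comp_def)
  then show "aff (fst H) (aff (snd H) t) = t" "aff (snd H) (aff (fst H) t) = t"
    using aff_one[OF assms(2)] aff_comp by metis+
qed

lemma volt_cases: "volt s S i p \<in> {hol1, hol\<alpha>, prod.swap hol\<alpha>, hol\<beta>, prod.swap hol\<beta>}"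
  by (simp add: volt_def Let_def)

text \<open>Two colours below 4 at distance at least 2 always include 0 or 3, whose edges are
  unmarked. Non-trivial affine maps therefore never have to commute; it is enough that marks are
  invariant under the commuting colour.\<close>

lemma involutive_action_twist:
  assumes a: "involutive_action n P s" and n: "n \<le> 4"
    and S: "\<And>i. S i \<subseteq> P" "S 0 = {}" "S 3 = {}" "\<And>i p. i < n \<Longrightarrow> p \<in> S i \<Longrightarrow> s i p \<notin> S i"
      "\<And>i j p. i < n \<Longrightarrow> j < n \<Longrightarrow> \<bar>int i - int j\<bar> \<ge> 2 \<Longrightarrow> p \<in> S i \<Longrightarrow> s j p \<in> S i"
  shows "involutive_action n (P \<times> {..<5::nat}) (twist s S)"
  unfolding involutive_action_def
proof (intro conjI allI impI ballI)
  fix i z assume i: "i < n" and "z \<in> P \<times> {..<5::nat}"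
  then obtain p t where z: "z = (p, t)" "p \<in> P" "t < 5" by auto
  show "twist s S i z \<in> P \<times> {..<5}" using z involutive_actionD[OF a i] by (simp add: twist_def)
  have "volt s S i (s i p) = prod.swap (volt s S i p)"
    using involutive_actionD(2)[OF a i z(2)] S(4)[OF i, of p]
    by (simp add: volt_def Let_def hol1_def)
  then show "twist s S i (twist s S i z) = z"
    using z involutive_actionD[OF a i z(2)] aff_inverse[OF volt_cases z(3)] by (simp add: twist_def)
next
  fix i j z assume ij: "i < n" "j < n" "\<bar>int i - int j\<bar> \<ge> 2" and "z \<in> P \<times> {..<5::nat}"
  then obtain p t where z: "z = (p, t)" "p \<in> P" "t < 5" by auto
  have inv: "volt s S i (s j p) = volt s S i p"
    if ij: "i < n" "j < n" "\<bar>int i - int j\<bar> \<ge> 2" for i j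
  proof -
    have S_iff: "s j p \<in> S i \<longleftrightarrow> p \<in> S i" if "p \<in> P" for p
      using S(5)[OF ij] involutive_actionD(2)[OF a ij(2) that] by metis
    have "s i (s j p) \<in> S i \<longleftrightarrow> s i p \<in> S i"
      using S_iff[OF involutive_actionD(1)[OF a ij(1) z(2)]] involutive_action_commute[OF a ij z(2)]
      by simp
    then show ?thesis using S_iff[OF z(2)] by (simp only: volt_def)
  qed
  have "volt s S i p = hol1 \<or> volt s S j p = hol1"
  proof -
    have "i = 0 \<or> i = 3 \<or> j = 0 \<or> j = 3" using ij n by arith
    then show ?thesis using S(2,3) by (auto simp: volt_def Let_def)
  qed
  moreover have "volt s S i (s j p) = volt s S i p" "volt s S j (s i p) = volt s S j p"
    using inv ij by auto
  ultimately show "twist s S i (twist s S j z) = twist s S j (twist s S i z)"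
    using z involutive_action_commute[OF a ij z(2)]
    by (auto simp: twist_def hol1_def aff_one[simplified])
qed

section \<open>Holonomy along alternating cycles\<close>

lemma fold_alternating: "fold s (concat (replicate k [i, j])) x = ((\<lambda>x. s j (s i x)) ^^ k) x"
  by (induction k arbitrary: x) (simp_all add: funpow_Suc_right del: funpow.simps(2))

lemma alternating_in_wrds: "i < n \<Longrightarrow> j < n \<Longrightarrow> concat (replicate k [i, j]) \<in> wrds n"
  by (induction k) simp_all

text \<open>After \<open>k\<close> steps the fibre coordinate has been changed by the product of the
  \<open>\<xi>\<close>-values along the cycle of \<open>g\<close>. All factors outside
  \<open>C\<close> are trivial and a period contains at most one visit to \<open>C\<close>, so at
  most one factor remains and no order of composition matters.\<close>

lemma single_crossing:
  fixes g :: "'p \<Rightarrow> 'p" and h :: "'p \<times> nat \<Rightarrow> 'p \<times> nat"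
  assumes h: "\<And>p t. p \<in> P \<Longrightarrow> t < 5 \<Longrightarrow> h (p, t) = (g p, aff (\<xi> p) t)"
    and g: "\<And>p. p \<in> P \<Longrightarrow> g p \<in> P" "\<And>p. p \<in> P \<Longrightarrow> (g ^^ k) p = p"
    and C: "\<And>p. p \<in> P \<Longrightarrow> p \<notin> C \<Longrightarrow> \<xi> p = (1, 0)"
      "\<And>p j. p \<in> P \<Longrightarrow> p \<in> C \<Longrightarrow> 0 < j \<Longrightarrow> j < k \<Longrightarrow> (g ^^ j) p \<notin> C"
    and p: "p \<in> P" and t: "t < 5"
  shows "(\<And>j. j < k \<Longrightarrow> (g ^^ j) p \<notin> C) \<Longrightarrow> (h ^^ k) (p, t) = (p, aff (1, 0) t)"
    and "j < k \<Longrightarrow> (g ^^ j) p \<in> C \<Longrightarrow> (h ^^ k) (p, t) = (p, aff (\<xi> ((g ^^ j) p)) t)"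
proof -
  have gP: "(g ^^ m) p \<in> P" for m using p g(1) by (induction m) auto
  {
    assume nc: "\<And>j. j < k \<Longrightarrow> (g ^^ j) p \<notin> C"
    have "m \<le> k \<Longrightarrow> (h ^^ m) (p, t) = ((g ^^ m) p, t)" for m
    proof (induction m)
      case (Suc m)
      then show ?case using h[OF gP t] C(1)[OF gP nc] t by (simp add: aff_one[simplified])
    qed simp
    then show "(h ^^ k) (p, t) = (p, aff (1, 0) t)" using g(2)[OF p] t by (simp add: aff_one[simplified])
  }
  assume j: "j < k" "(g ^^ j) p \<in> C"
  have nc: "(g ^^ m) p \<notin> C" if m: "m < k" "m \<noteq> j" for m
  proof
    assume mC: "(g ^^ m) p \<in> C"
    have *: "(g ^^ (b - a)) ((g ^^ a) p) = (g ^^ b) p" if "a \<le> b" for a b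
      using that by (simp flip: funpow_add[THEN fun_cong, unfolded o_def])
    show False
    proof (cases "m < j")
      case True
      then show False using C(2)[OF gP mC, of "j - m"] *[of m j] True j less_imp_diff_less by simp
    next
      case False
      then show False using C(2)[OF gP j(2), of "m - j"] *[of j m] False m mC less_imp_diff_less by simp
    qed
  qed
  have "m \<le> k \<Longrightarrow> (h ^^ m) (p, t) = ((g ^^ m) p, if j < m then aff (\<xi> ((g ^^ j) p)) t else t)" for m
  proof (induction m)
    case (Suc m)
    then show ?case
      using h[OF gP, of _ m] C(1)[OF gP nc, of m] t
      by (cases "m = j") (auto simp: aff_one[simplified] less_Suc_eq)
  qed simp
  from this[OF order_refl] show "(h ^^ k) (p, t) = (p, aff (\<xi> ((g ^^ j) p)) t)" using g(2)[OF p] j by simp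
qed

lemma funpow_id_on_finite:
  assumes "finite V" "inj_on f V" "\<And>x. x \<in> V \<Longrightarrow> f x \<in> V"
  obtains k where "k > 0" "\<And>x. x \<in> V \<Longrightarrow> (f ^^ k) x = x"
proof -
  \<comment> \<open>Extension by the identity gives a permutation that moves points of a finite set
    only, and such a permutation has finite order.\<close>
  define f' where "f' x = (if x \<in> V then f x else x)" for x
  have "f ` V = V" using endo_inj_surj[OF assms(1) _ assms(2)] assms(3) by blast
  moreover have "bij_betw f' V V \<longleftrightarrow> bij_betw f V V" by (rule bij_betw_cong) (simp add: f'_def)
  ultimately have "bij_betw f' V V" using assms(2) by (simp add: bij_betw_def)
  then have "f' permutes V" by (rule bij_imp_permutes) (simp add: f'_def)
  then have "permutation f'" using assms(1) by (auto simp: permutation_permutes)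
  then obtain k where k: "f' ^^ k = id" "k > 0" by (rule permutation_is_nilpotent)
  have "(f ^^ m) x = (f' ^^ m) x \<and> (f ^^ m) x \<in> V" if "x \<in> V" for x m
    using assms(3) that by (induction m) (auto simp: f'_def)
  then show thesis using k by (intro that[of k]) auto
qed

section \<open>Covers with a word moving a single fibre\<close>

text \<open>The two generating reflections of a dihedral group of order \<open>2k\<close>, acting regularly on the flags
  of a \<open>k\<close>-gon.\<close>

definition refl0 :: "int \<times> bool \<Rightarrow> int \<times> bool" where
  "refl0 d = (fst d, \<not> snd d)"

definition refl1 :: "int \<Rightarrow> int \<times> bool \<Rightarrow> int \<times> bool" where
  "refl1 k d = ((if snd d then fst d + 1 else fst d - 1) mod k, \<not> snd d)"

abbreviation polygon_flags :: "int \<Rightarrow> (int \<times> bool) set" where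
  "polygon_flags k \<equiv> {0..<k} \<times> UNIV"

lemma refl0_simps [simp]: "refl0 (m, b) = (m, \<not> b)" "refl0 (refl0 d) = d"
  by (simp_all add: refl0_def)

lemma refl0_in [simp]: "d \<in> polygon_flags k \<Longrightarrow> refl0 d \<in> polygon_flags k"
  by (auto simp: refl0_def)

lemma refl1_in [simp]: "d \<in> polygon_flags k \<Longrightarrow> refl1 k d \<in> polygon_flags k"
  by (auto simp: refl1_def)

lemma refl1_refl1 [simp]: "d \<in> polygon_flags k \<Longrightarrow> refl1 k (refl1 k d) = d"
  by (auto simp: refl1_def mod_simps)

lemma funpow_ident [simp]: "((\<lambda>x. x) ^^ m) x = x"
  by (induction m) auto

text \<open>The product of the two reflections rotates by one step. It keeps the Boolean, which
  fixes the direction of rotation, while \<open>refl1\<close> changes it; so the two ends of an edge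
  along which the flag is reflected lie on different orbits of the rotation.\<close>

lemma funpow_refl01: "d \<in> polygon_flags k \<Longrightarrow>
    ((\<lambda>d. refl0 (refl1 k d)) ^^ j) d = ((if snd d then fst d + int j else fst d - int j) mod k, snd d)"
  by (induction j) (auto simp: refl0_def refl1_def mod_simps algebra_simps)

lemma funpow_refl10: "d \<in> polygon_flags k \<Longrightarrow>
    ((\<lambda>d. refl1 k (refl0 d)) ^^ j) d = ((if snd d then fst d - int j else fst d + int j) mod k, snd d)"
  by (induction j) (auto simp: refl0_def refl1_def mod_simps algebra_simps)

lemma funpow_refl1: "d \<in> polygon_flags k \<Longrightarrow> (refl1 k ^^ j) d = (if even j then d else refl1 k d)"
  by (induction j) auto

section \<open>Products with flag actions\<close>

definition prod_act :: "(nat \<Rightarrow> 'a \<Rightarrow> 'a) \<Rightarrow> (nat \<Rightarrow> 'b \<Rightarrow> 'b) \<Rightarrow> (nat \<Rightarrow> 'c \<Rightarrow> 'c) \<Rightarrow> nat \<Rightarrow> 'a \<times> 'b \<times> 'c \<Rightarrow> 'a \<times> 'b \<times> 'c" where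
  "prod_act s D E i p = (s i (fst p), D i (fst (snd p)), E i (snd (snd p)))"

lemma prod_act_Pair [simp]: "prod_act s D E i (x, d, e) = (s i x, D i d, E i e)"
  by (simp add: prod_act_def)

lemma involutive_action_prod:
  assumes "involutive_action n V s" "involutive_action n A D" "involutive_action n B E"
  shows "involutive_action n (V \<times> A \<times> B) (prod_act s D E)"
  using assms unfolding involutive_action_def by (auto simp: prod_act_def)

lemma funpow_prod_act:
  "((\<lambda>p. prod_act s D E j (prod_act s D E i p)) ^^ m) (x, d, e) =
    (((\<lambda>x. s j (s i x)) ^^ m) x, ((\<lambda>d. D j (D i d)) ^^ m) d, ((\<lambda>e. E j (E i e)) ^^ m) e)"
  by (induction m) simp_all

definition flag_act :: "int \<Rightarrow> nat \<Rightarrow> nat \<Rightarrow> nat \<Rightarrow> int \<times> bool \<Rightarrow> int \<times> bool" where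
  "flag_act k a b i d = (if i = a then refl0 d else if i = b then refl1 k d else d)"

text \<open>Colours at distance at least 2 cannot be both \<open>a\<close> and \<open>b\<close>, so
  one of them acts trivially and the non-commuting reflections never meet.\<close>

lemma involutive_action_flag_act:
  assumes "\<bar>int a - int b\<bar> = 1"
  shows "involutive_action n (polygon_flags k) (flag_act k a b)"
  unfolding involutive_action_def
proof (intro conjI allI impI ballI)
  fix i d assume "d \<in> polygon_flags k"
  then show "flag_act k a b i d \<in> polygon_flags k" "flag_act k a b i (flag_act k a b i d) = d"
    by (simp_all add: flag_act_def del: mem_Times_iff)
next
  fix i j d assume "\<bar>int i - int j\<bar> \<ge> 2"
  then show "flag_act k a b i (flag_act k a b j d) = flag_act k a b j (flag_act k a b i d)"
    using assms by (auto simp: flag_act_def)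
qed

lemma funpow_mult_id: "(f ^^ a) x = x \<Longrightarrow> (f ^^ (a * b)) x = x"
  by (induction b) (simp_all add: funpow_add)

text \<open>The factor 4 makes the product of the two periods even and at least 4. Rank 3 needs
  both: there a flag is reflected at every step and returns after an even number of steps only, and
  0, 1, \<open>k - 2\<close>, \<open>k - 1\<close> must be distinct.\<close>

lemma common_period:
  assumes a: "involutive_action n V s" and fV: "finite V" and "i < n" "j < n" "i' < n" "j' < n"
  obtains k where "k \<ge> 4" "even k" "\<And>x. x \<in> V \<Longrightarrow> ((\<lambda>x. s j (s i x)) ^^ k) x = x"
    "\<And>x. x \<in> V \<Longrightarrow> ((\<lambda>x. s j' (s i' x)) ^^ k) x = x"
proof -
  have inj: "inj_on (\<lambda>x. s j (s i x)) V" if "i < n" "j < n" for i j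
    by (rule inj_on_inverseI[where g="\<lambda>x. s i (s j x)"])
      (simp add: involutive_actionD[OF a] that)
  obtain k1 where k1: "k1 > 0" "\<And>x. x \<in> V \<Longrightarrow> ((\<lambda>x. s j (s i x)) ^^ k1) x = x"
    by (rule funpow_id_on_finite[OF fV inj[OF assms(3,4)]])
      (auto simp: involutive_actionD[OF a] assms)
  obtain k2 where k2: "k2 > 0" "\<And>x. x \<in> V \<Longrightarrow> ((\<lambda>x. s j' (s i' x)) ^^ k2) x = x"
    by (rule funpow_id_on_finite[OF fV inj[OF assms(5,6)]])
      (auto simp: involutive_actionD[OF a] assms)
  show thesis
  proof (rule that)
    show "4 \<le> k1 * k2 * 4" using k1(1) k2(1) by simp
    show "even (k1 * k2 * 4)" by simp
    show "((\<lambda>x. s j (s i x)) ^^ (k1 * k2 * 4)) x = x" if "x \<in> V" for x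
      using funpow_mult_id[OF k1(2)[OF that], of "k2 * 4"] by (simp add: mult.assoc)
    show "((\<lambda>x. s j' (s i' x)) ^^ (k1 * k2 * 4)) x = x" if "x \<in> V" for x
      using funpow_mult_id[OF k2(2)[OF that], of "k1 * 4"] by (simp add: ac_simps)
  qed
qed

text \<open>\<open>X p\<close> is the voltage collected by one step of colour \<open>i\<close>
  followed by one of colour \<open>j\<close>. \<open>C\<close> only has to contain the points where
  it is non-trivial and may be larger.\<close>

lemma holonomy_alternating:
  assumes T: "involutive_action n (P \<times> {..<5::nat}) h" and ij: "i < n" "j < n"
    and h: "\<And>p t. p \<in> P \<Longrightarrow> t < 5 \<Longrightarrow> h j (h i (p, t)) = (g p, aff (fst (X p)) t)"
    and X: "\<And>p. p \<in> P \<Longrightarrow> X p \<in> {hol1, hol\<alpha>, prod.swap hol\<alpha>, hol\<beta>, prod.swap hol\<beta>}"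
    and g: "\<And>p. p \<in> P \<Longrightarrow> g p \<in> P" "\<And>p. p \<in> P \<Longrightarrow> (g ^^ k) p = p"
    and C: "\<And>p. p \<in> P \<Longrightarrow> p \<notin> C \<Longrightarrow> X p = hol1"
      "\<And>p m. p \<in> P \<Longrightarrow> p \<in> C \<Longrightarrow> 0 < m \<Longrightarrow> m < k \<Longrightarrow> (g ^^ m) p \<notin> C"
    and p: "p \<in> P"
  shows "holonomy h p (concat (replicate k [i, j])) hol1 \<or>
      (\<exists>m<k. (g ^^ m) p \<in> C \<and> holonomy h p (concat (replicate k [i, j])) (X ((g ^^ m) p)))"
    and "m < k \<Longrightarrow> (g ^^ m) p \<in> C \<Longrightarrow> holonomy h p (concat (replicate k [i, j])) (X ((g ^^ m) p))"
proof -
  let ?w = "concat (replicate k [i, j])"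
  note w = alternating_in_wrds[OF ij, of k]
  have C1: "fst (X p) = (1, 0)" if "p \<in> P" "p \<notin> C" for p
    using C(1)[OF that] by (simp add: hol1_def)
  have gP: "(g ^^ m) p \<in> P" for m using p g(1) by (induction m) auto
  have sc1: "((\<lambda>z. h j (h i z)) ^^ k) (p, t) = (p, aff (1, 0) t)"
    if "t < 5" "\<And>m. m < k \<Longrightarrow> (g ^^ m) p \<notin> C" for t
    using h g C1 C(2) p that by (rule single_crossing(1)[where \<xi> = "\<lambda>p. fst (X p)"])
  have sc2: "((\<lambda>z. h j (h i z)) ^^ k) (p, t) = (p, aff (fst (X ((g ^^ m) p))) t)"
    if "t < 5" "m < k" "(g ^^ m) p \<in> C" for t m
    using h g C1 C(2) p that by (rule single_crossing(2)[where \<xi> = "\<lambda>p. fst (X p)"])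
  show *: "holonomy h p ?w (X ((g ^^ m) p))" if m: "m < k" "(g ^^ m) p \<in> C" for m
  proof -
    have "holonomy h p ?w (fst (X ((g ^^ m) p)), snd (X ((g ^^ m) p)))"
      by (rule holonomyI[OF T w p])
        (simp_all only: fold_alternating sc2[OF _ m] aff_inverse[OF X[OF gP]])
    then show ?thesis by simp
  qed
  show "holonomy h p ?w hol1 \<or> (\<exists>m<k. (g ^^ m) p \<in> C \<and> holonomy h p ?w (X ((g ^^ m) p)))"
  proof (cases "\<exists>m<k. (g ^^ m) p \<in> C")
    case True
    then show ?thesis using * by blast
  next
    case False
    have "holonomy h p ?w ((1, 0), (1, 0))"
      by (rule holonomyI[OF T w p]) (use False in \<open>auto simp: fold_alternating sc1 aff_one simp del: One_nat_def\<close>)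
    then show ?thesis by (simp add: hol1_def)
  qed
qed

text \<open>The part common to both ranks. What remains to be supplied is a set of marked edges and
  two closed words that see \<open>hol\<alpha>\<close> and \<open>hol\<beta>\<close> simultaneously
  from \<open>c\<close> only.\<close>

lemma twist_cover:
  fixes s :: "nat \<Rightarrow> 'p \<Rightarrow> 'p"
  assumes a: "involutive_action n P s" and fP: "finite P" and n: "n \<le> 4"
    and S: "\<And>i. S i \<subseteq> P" "S 0 = {}" "S 3 = {}" "\<And>i p. i < n \<Longrightarrow> p \<in> S i \<Longrightarrow> s i p \<notin> S i"
      "\<And>i j p. i < n \<Longrightarrow> j < n \<Longrightarrow> \<bar>int i - int j\<bar> \<ge> 2 \<Longrightarrow> p \<in> S i \<Longrightarrow> s j p \<in> S i"
    and fp: "\<And>i p. i < n \<Longrightarrow> p \<in> P \<Longrightarrow> s i p \<noteq> p"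
    and ds: "\<And>i j p. i < n \<Longrightarrow> j < n \<Longrightarrow> i \<noteq> j \<Longrightarrow> p \<in> P \<Longrightarrow> s i p \<noteq> s j p"
    and c: "c \<in> P" and y: "y1 \<in> wrds n" "y2 \<in> wrds n"
    and hol: "holonomy (twist s S) c y1 hol\<alpha>" "holonomy (twist s S) c y2 hol\<beta>"
      "\<And>p. p \<in> P \<Longrightarrow> \<exists>A B. A \<in> {hol1, hol\<alpha>, prod.swap hol\<alpha>} \<and>
      B \<in> {hol1, hol\<alpha>, prod.swap hol\<alpha>, hol\<beta>, prod.swap hol\<beta>} \<and>
      holonomy (twist s S) p y1 A \<and> holonomy (twist s S) p y2 B \<and> (A = hol\<alpha> \<longrightarrow> B = hol\<beta> \<longrightarrow> p = c)"
  obtains Z :: "('p \<times> nat) set" and sZ y z0 where "involutive_action n Z sZ" "finite Z" "Z \<subseteq> P \<times> UNIV"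
    "\<And>i z. fst (sZ i z) = s i (fst z)" "\<And>i z. i < n \<Longrightarrow> z \<in> Z \<Longrightarrow> sZ i z \<noteq> z"
    "\<And>i j z. i < n \<Longrightarrow> j < n \<Longrightarrow> i \<noteq> j \<Longrightarrow> z \<in> Z \<Longrightarrow> sZ i z \<noteq> sZ j z"
    "y \<in> wrds n" "z0 \<in> Z" "fold sZ y z0 \<noteq> z0"
    "\<And>z. z \<in> Z \<Longrightarrow> fold sZ y z \<noteq> z \<Longrightarrow> fst z = fst z0"
proof (rule that)
  show "involutive_action n (P \<times> {..<5}) (twist s S)"
    by (rule involutive_action_twist[OF a n S])
  show "finite (P \<times> {..<5::nat})" using fP by simp
  show "word_isolate y1 y2 \<in> wrds n"
    using y by (simp add: word_isolate_def word_kill_def word_comm_def)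
  show "(c, 0) \<in> P \<times> {..<5::nat}" using c by simp
  show "fold (twist s S) (word_isolate y1 y2) (c, 0) \<noteq> (c, 0)"
    using word_isolate_moves_only(1)[OF hol] .
  show "fst z = fst (c, 0)" if "z \<in> P \<times> {..<5::nat}" "fold (twist s S) (word_isolate y1 y2) z \<noteq> z" for z
    using word_isolate_moves_only(2)[OF hol that] by simp
  show "twist s S i z \<noteq> z" if "i < n" "z \<in> P \<times> {..<5::nat}" for i z
    using fp[OF that(1), of "fst z"] that(2) by (auto simp: twist_def prod_eq_iff)
  show "twist s S i z \<noteq> twist s S j z" if "i < n" "j < n" "i \<noteq> j" "z \<in> P \<times> {..<5::nat}" for i j z
    using ds[OF that(1-3), of "fst z"] that(4) by (auto simp: twist_def prod_eq_iff)
qed (auto simp: twist_def)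


section \<open>Marked edges and their cycles in rank 4\<close>

lemma hol_distinct: "hol1 \<noteq> hol\<alpha>" "hol1 \<noteq> hol\<beta>" "prod.swap hol\<alpha> \<noteq> hol\<alpha>" "prod.swap hol\<beta> \<noteq> hol\<beta>"
    "hol\<alpha> \<noteq> hol\<beta>" "prod.swap hol\<alpha> \<noteq> hol\<beta>"
  by (simp_all add: hol1_def hol\<alpha>_def hol\<beta>_def)

lemma volt_1: "volt s S 1 p \<in> {hol1, hol\<alpha>, prod.swap hol\<alpha>}" "volt s S 1 p = hol\<alpha> \<longleftrightarrow> p \<in> S 1"
  using hol_distinct by (auto simp: volt_def)

lemma volt_2: "volt s S 2 p \<in> {hol1, hol\<beta>, prod.swap hol\<beta>}" "volt s S 2 p = hol\<beta> \<longleftrightarrow> p \<in> S 2"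
  using hol_distinct by (auto simp: volt_def)

lemma volt_eq_hol1: "p \<notin> S i \<Longrightarrow> s i p \<notin> S i \<Longrightarrow> volt s S i p = hol1"
  by (simp add: volt_def)

lemma mod_shift_ne:
  assumes "0 < j" "j < k"
  shows "(a + int j) mod int k \<noteq> a mod int k" "(a - int j) mod int k \<noteq> a mod int k"
  using assms zdvd_not_zless[of "int j" "int k"] by (auto simp: mod_eq_dvd_iff)

text \<open>The pairs of colours 1, 0 and 2, 3 are disjoint, so each of the two words rotates one
  flag and leaves the other alone.\<close>

lemma moving_cover_rank4:
  fixes s :: "nat \<Rightarrow> 'v \<Rightarrow> 'v"
  assumes V: "involutive_action 4 V s" and fV: "finite V" and x0: "x0 \<in> V"
  obtains Z :: "(('v \<times> (int \<times> bool) \<times> (int \<times> bool)) \<times> nat) set" and sZ y z0 where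
    "involutive_action 4 Z sZ" "finite Z" "\<And>z. z \<in> Z \<Longrightarrow> fst (fst z) \<in> V"
    "\<And>i z. fst (fst (sZ i z)) = s i (fst (fst z))" "\<And>i z. i < 4 \<Longrightarrow> z \<in> Z \<Longrightarrow> sZ i z \<noteq> z"
    "\<And>i j z. i < 4 \<Longrightarrow> j < 4 \<Longrightarrow> i \<noteq> j \<Longrightarrow> z \<in> Z \<Longrightarrow> sZ i z \<noteq> sZ j z"
    "y \<in> wrds 4" "z0 \<in> Z" "fold sZ y z0 \<noteq> z0"
    "\<And>z. z \<in> Z \<Longrightarrow> fold sZ y z \<noteq> z \<Longrightarrow> fst (fst z) = fst (fst z0)"
proof -
  obtain k where k: "k \<ge> 4" "even k" "\<And>x. x \<in> V \<Longrightarrow> ((\<lambda>x. s 0 (s 1 x)) ^^ k) x = x"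
    "\<And>x. x \<in> V \<Longrightarrow> ((\<lambda>x. s 3 (s 2 x)) ^^ k) x = x"
    by (rule common_period[OF V fV, of 1 0 2 3]) auto
  let ?k = "int k"
  define D where "D = flag_act ?k 0 1"
  define E where "E = flag_act ?k 3 2"
  have D: "D 0 = refl0" "D 1 = refl1 ?k" "D (Suc 0) = refl1 ?k" "D 2 = (\<lambda>d. d)" "D 3 = (\<lambda>d. d)"
    and E: "E 0 = (\<lambda>d. d)" "E 1 = (\<lambda>d. d)" "E (Suc 0) = (\<lambda>d. d)" "E 2 = refl1 ?k" "E 3 = refl0"
    by (auto simp: D_def E_def flag_act_def)
  define P where "P = V \<times> polygon_flags ?k \<times> polygon_flags ?k"
  define q where "q = prod_act s D E"
  note involutive_action_prod[OF V involutive_action_flag_act[of 0 1 4 ?k] involutive_action_flag_act[of 3 2 4 ?k]]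
  then have a: "involutive_action 4 P q" by (simp add: P_def q_def D_def E_def)
  have q: "q i (x, d, e) = (s i x, D i d, E i e)" for i x d e by (simp add: q_def)
  have fP: "finite P" using fV by (simp add: P_def)
  define c where "c = (x0, (0 :: int, False), (0 :: int, False))"
  have c: "c \<in> P" using x0 k by (simp add: c_def P_def)
  \<comment> \<open>The edges of colour 1 are closed up under colour 3 and those of colour 2 under colour 0, as the
    4-cycles of commuting colours require.\<close>
  define S where "S i = (if i = 1 then {c, q 3 c} else if i = 2 then {c, q 0 c} else {})" for i :: nat
  have S12: "S 1 = {c, q 3 c}" "S (Suc 0) = {c, q 3 c}" "S 2 = {c, q 0 c}" by (simp_all add: S_def)
  have S0: "S 0 = {}" "S 3 = {}" by (simp_all add: S_def)
  have qc: "q 3 c = (s 3 x0, (0, False), (0, True))" "q 0 c = (s 0 x0, (0, True), (0, False))"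
    by (simp_all add: c_def q D E)
  have Sx: "S 1 = {(x0, (0, False), (0, False)), (s 3 x0, (0, False), (0, True))}"
      "S 2 = {(x0, (0, False), (0, False)), (s 0 x0, (0, True), (0, False))}"
      "S (Suc 0) = {(x0, (0, False), (0, False)), (s 3 x0, (0, False), (0, True))}"
    unfolding S12 qc by (simp_all add: c_def)
  have four: "i = 0 \<or> i = 1 \<or> i = 2 \<or> i = 3" if "i < 4" for i :: nat using that by auto
  have SP: "S i \<subseteq> P" for i using c involutive_actionD(1)[OF a _ c] by (auto simp: S_def)
  have Sdisj: "q i p \<notin> S i" if "i < 4" "p \<in> S i" for i p
    using four[OF that(1)] that(2) by (auto simp: S12 S0 qc c_def q D E refl1_def)
  have Sinv: "q j p \<in> S i" if "i < 4" "j < 4" "\<bar>int i - int j\<bar> \<ge> 2" "p \<in> S i" for i j p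
    using four[OF that(1)] four[OF that(2)] that(3,4) involutive_actionD(2)[OF a _ c]
    by (elim disjE) (auto simp: S12 S0)
  \<comment> \<open>The flags exclude fixed points and coinciding neighbours whatever
    \<open>V\<close> is: two colours either move different flags, or act on the same flag by the two
    reflections, which differ because \<open>k > 1\<close>.\<close>
  have ref: "refl1 ?k d \<noteq> refl0 d" if "d \<in> polygon_flags ?k" for d
    using k mod_shift_ne[of 1 k "fst d"] that by (auto simp: refl1_def refl0_def split: if_splits)
  have ref': "refl1 ?k d \<noteq> d" "refl0 d \<noteq> d" for d by (auto simp: refl1_def refl0_def prod_eq_iff)
  have fp: "q i p \<noteq> p" if "i < 4" "p \<in> P" for i p
    using four[OF that(1)] ref' by (cases p) (auto simp: q D E)
  have ds: "q i p \<noteq> q j p" if ij: "i < 4" "j < 4" "i \<noteq> j" and p: "p \<in> P" for i j p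
  proof -
    obtain x d e where xde: "p = (x, d, e)" "d \<in> polygon_flags ?k" "e \<in> polygon_flags ?k"
      using p by (auto simp: P_def)
    note r = ref[OF xde(2)] ref[OF xde(3)] ref'[of d] ref'[of e]
    show ?thesis using four[OF ij(1)] four[OF ij(2)] ij(3) r r[symmetric]
      by (elim disjE) (simp_all add: xde(1) q D E)
  qed
  note T = involutive_action_twist[OF a order_refl SP S0 Sdisj Sinv]
  let ?T = "twist q S"
  define g1 where "g1 p = q 0 (q 1 p)" for p
  define g2 where "g2 p = q 3 (q 2 p)" for p
  have g1: "(g1 ^^ m) (x, d, e) = (((\<lambda>x. s 0 (s 1 x)) ^^ m) x,
      ((if snd d then fst d + int m else fst d - int m) mod ?k, snd d), e)"
    if "d \<in> polygon_flags ?k" for m x d e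
    using funpow_prod_act[where s=s and D=D and E=E and j=0 and i=1 and m=m] funpow_refl01[OF that, of m]
    by (simp add: g1_def[abs_def] q_def D E)
  have g2: "(g2 ^^ m) (x, d, e) = (((\<lambda>x. s 3 (s 2 x)) ^^ m) x, d,
      ((if snd e then fst e + int m else fst e - int m) mod ?k, snd e))"
    if "e \<in> polygon_flags ?k" for m x d e
    using funpow_prod_act[where s=s and D=D and E=E and j=3 and i=2 and m=m] funpow_refl01[OF that, of m]
    by (simp add: g2_def[abs_def] q_def D E)
  have g1P: "g1 p \<in> P" "(g1 ^^ k) p = p" and g2P: "g2 p \<in> P" "(g2 ^^ k) p = p" if "p \<in> P" for p
    using that involutive_actionD(1)[OF a] k(3,4) by (auto simp: P_def g1 g2 g1_def g2_def)
  define C1 where "C1 = {p \<in> P. fst (snd p) \<in> {(0, False), refl1 ?k (0, False)}}"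
  define C2 where "C2 = {p \<in> P. snd (snd p) \<in> {(0, False), refl1 ?k (0, False)}}"
  have C1: "volt q S 1 p = hol1" if "p \<in> P" "p \<notin> C1" for p
  proof (rule volt_eq_hol1)
    obtain x d e where p1: "p = (x, d, e)" by (cases p)
    have p: "p = (x, d, e)" "d \<in> polygon_flags ?k" "d \<noteq> (0, False)" "d \<noteq> refl1 ?k (0, False)"
      using that by (simp_all add: C1_def P_def p1)
    show "p \<notin> S 1" "q 1 p \<notin> S 1"
      using p(3,4) refl1_refl1[OF p(2)] by (auto simp: p(1) S12 qc c_def q D)
  qed
  have C2: "volt q S 2 p = hol1" if "p \<in> P" "p \<notin> C2" for p
  proof (rule volt_eq_hol1)
    obtain x d e where p1: "p = (x, d, e)" by (cases p)
    have p: "p = (x, d, e)" "e \<in> polygon_flags ?k" "e \<noteq> (0, False)" "e \<noteq> refl1 ?k (0, False)"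
      using that by (simp_all add: C2_def P_def p1)
    show "p \<notin> S 2" "q 2 p \<notin> S 2"
      using p(3,4) refl1_refl1[OF p(2)] by (auto simp: p(1) S12 qc c_def q E)
  qed
  have C1': "(g1 ^^ m) p \<notin> C1" if "p \<in> C1" "0 < m" "m < k" for p m
    using that(1) mod_shift_ne[OF that(2,3), of 0] mod_shift_ne[OF that(2,3), of "-1"]
    by (auto simp: C1_def P_def g1 refl1_def mod_simps)
  have C2': "(g2 ^^ m) p \<notin> C2" if "p \<in> C2" "0 < m" "m < k" for p m
    using that(1) mod_shift_ne[OF that(2,3), of 0] mod_shift_ne[OF that(2,3), of "-1"]
    by (auto simp: C2_def P_def g2 refl1_def mod_simps)
  have h1: "?T 0 (?T 1 (p, t)) = (g1 p, aff (fst (volt q S 1 p)) t)"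
    and h2: "?T 3 (?T 2 (p, t)) = (g2 p, aff (fst (volt q S 2 p)) t)" for p t
    using S0 by (simp_all add: twist_def g1_def g2_def volt_eq_hol1) (simp_all add: hol1_def aff_def)
  let ?y1 = "concat (replicate k [1, 0])" and ?y2 = "concat (replicate k [2, 3])"
  have lt1: "1 < (4::nat)" "0 < (4::nat)" and lt2: "2 < (4::nat)" "3 < (4::nat)" by simp_all
  have ha1: "holonomy ?T p ?y1 hol1 \<or> (\<exists>m<k. (g1 ^^ m) p \<in> C1 \<and> holonomy ?T p ?y1 (volt q S 1 ((g1 ^^ m) p)))"
    if p: "p \<in> P" for p
    using T lt1 h1 volt_cases g1P C1 C1' p by (rule holonomy_alternating(1))
  have hb1: "holonomy ?T p ?y1 (volt q S 1 ((g1 ^^ m) p))"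
    if p: "p \<in> P" and m: "m < k" "(g1 ^^ m) p \<in> C1" for p m
    using T lt1 h1 volt_cases g1P C1 C1' p m by (rule holonomy_alternating(2))
  have ha2: "holonomy ?T p ?y2 hol1 \<or> (\<exists>m<k. (g2 ^^ m) p \<in> C2 \<and> holonomy ?T p ?y2 (volt q S 2 ((g2 ^^ m) p)))"
    if p: "p \<in> P" for p
    using T lt2 h2 volt_cases g2P C2 C2' p by (rule holonomy_alternating(1))
  have hb2: "holonomy ?T p ?y2 (volt q S 2 ((g2 ^^ m) p))"
    if p: "p \<in> P" and m: "m < k" "(g2 ^^ m) p \<in> C2" for p m
    using T lt2 h2 volt_cases g2P C2 C2' p m by (rule holonomy_alternating(2))
  have "c \<in> C1" "c \<in> C2" using c by (auto simp: C1_def C2_def c_def)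
  then have hc: "holonomy ?T c ?y1 hol\<alpha>" "holonomy ?T c ?y2 hol\<beta>"
    using hb1[OF c, of 0] hb2[OF c, of 0] k(1) volt_1(2)[of q S c] volt_2(2)[of q S c] S12 by auto
  \<comment> \<open>\<open>g1\<close> keeps \<open>e\<close> and the Boolean of \<open>d\<close>,
    while \<open>g2\<close> keeps \<open>d\<close> and the Boolean of \<open>e\<close>. Meeting
    \<open>S 1\<close> along one cycle and \<open>S 2\<close> along the other thus forces both flags
    of \<open>p\<close> to be \<open>(0, False)\<close>; then no rotation has taken place, and
    \<open>p\<close> itself lies in \<open>S 1\<close>.\<close>
  have isolate: "p = c" if p: "p \<in> P" and 1: "m < k" "(g1 ^^ m) p \<in> S 1" and 2: "m' < k" "(g2 ^^ m') p \<in> S 2" for p m m'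
  proof -
    obtain x d e where xde: "p = (x, d, e)" "d \<in> polygon_flags ?k" "e \<in> polygon_flags ?k"
      using p by (auto simp: P_def)
    have "snd d = False" "e \<in> {(0, False), (0, True)}" "snd e = False" "d \<in> {(0, False), (0, True)}"
      using 1(2) 2(2) by (auto simp: xde(1) g1[OF xde(2)] g2[OF xde(3)] Sx c_def)
    then have de: "d = (0, False)" "e = (0, False)" by auto
    have "(- int m) mod ?k = 0" using 1(2) k(1) by (auto simp: xde(1) de g1 Sx c_def)
    then have "m = 0" using mod_shift_ne(2)[of m k 0] 1(1) by (cases "m = 0") auto
    then show ?thesis using 1(2) by (auto simp: xde(1) de Sx c_def)
  qed
  have main: "\<exists>A B. A \<in> {hol1, hol\<alpha>, prod.swap hol\<alpha>} \<and>
      B \<in> {hol1, hol\<alpha>, prod.swap hol\<alpha>, hol\<beta>, prod.swap hol\<beta>} \<and>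
      holonomy ?T p ?y1 A \<and> holonomy ?T p ?y2 B \<and> (A = hol\<alpha> \<longrightarrow> B = hol\<beta> \<longrightarrow> p = c)" if p: "p \<in> P" for p
  proof -
    obtain A where A: "A \<in> {hol1, hol\<alpha>, prod.swap hol\<alpha>}" "holonomy ?T p ?y1 A"
        "A = hol\<alpha> \<longrightarrow> (\<exists>m<k. (g1 ^^ m) p \<in> S 1)"
      using ha1[OF p] volt_1 hol_distinct by (metis insertI1)
    obtain B where B: "B \<in> {hol1, hol\<beta>, prod.swap hol\<beta>}" "holonomy ?T p ?y2 B"
        "B = hol\<beta> \<longrightarrow> (\<exists>m<k. (g2 ^^ m) p \<in> S 2)"
      using ha2[OF p] volt_2 hol_distinct by (metis insertI1)
    show ?thesis using A B isolate[OF p] by blast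
  qed
  have y: "?y1 \<in> wrds 4" "?y2 \<in> wrds 4" by (rule alternating_in_wrds; simp)+
  show thesis using a fP order_refl SP S0 Sdisj Sinv fp ds c y hc main
  proof (rule twist_cover)
    fix Z :: "(('v \<times> (int \<times> bool) \<times> (int \<times> bool)) \<times> nat) set" and sZ y z0
    assume Z: "involutive_action 4 Z sZ" "finite Z" "Z \<subseteq> P \<times> UNIV"
      "\<And>i z. fst (sZ i z) = q i (fst z)" "\<And>i z. i < 4 \<Longrightarrow> z \<in> Z \<Longrightarrow> sZ i z \<noteq> z"
      "\<And>i j z. i < 4 \<Longrightarrow> j < 4 \<Longrightarrow> i \<noteq> j \<Longrightarrow> z \<in> Z \<Longrightarrow> sZ i z \<noteq> sZ j z"
      "y \<in> wrds 4" "z0 \<in> Z" "fold sZ y z0 \<noteq> z0"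
      "\<And>z. z \<in> Z \<Longrightarrow> fold sZ y z \<noteq> z \<Longrightarrow> fst z = fst z0"
    show thesis
    proof (rule that)
      show "fst (fst z) \<in> V" if "z \<in> Z" for z using Z(3) that by (auto simp: P_def)
      show "fst (fst (sZ i z)) = s i (fst (fst z))" for i z by (simp add: Z(4) q_def prod_act_def)
      show "fst (fst z) = fst (fst z0)" if "z \<in> Z" "fold sZ y z \<noteq> z" for z
        using Z(10)[OF that] by simp
    qed (use Z in simp_all)
  qed
qed

section \<open>Marked edges and their cycles in rank 3\<close>

lemma refl1_values:
  assumes "k \<ge> 4"
  shows "refl1 (int k) (0, False) = (int k - 1, True)" "refl1 (int k) (int k - 1, True) = (0, False)"
    "refl1 (int k) (int k - 1, False) = (int k - 2, True)" "refl1 (int k) (int k - 2, True) = (int k - 1, False)"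
    "refl1 (int k) (0, True) = (1, False)" "refl1 (int k) (1, False) = (0, True)"
proof -
  have "(-2 + int k) mod int k = -2 + int k" by (rule mod_pos_pos_trivial) (use assms in auto)
  then have "- 2 mod int k = int k - 2" by simp
  then show "refl1 (int k) (0, False) = (int k - 1, True)" "refl1 (int k) (int k - 1, True) = (0, False)"
    "refl1 (int k) (int k - 1, False) = (int k - 2, True)" "refl1 (int k) (int k - 2, True) = (int k - 1, False)"
    "refl1 (int k) (0, True) = (1, False)" "refl1 (int k) (1, False) = (0, True)"
    using assms zmod_minus1[of "int k"] by (simp_all add: refl1_def)
qed

lemma refl1_eq_iff: "d \<in> polygon_flags k \<Longrightarrow> d' \<in> polygon_flags k \<Longrightarrow> refl1 k d = d' \<longleftrightarrow> d = refl1 k d'"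
  by (metis refl1_refl1)

lemma refl1_eq_values:
  assumes "k \<ge> 4" "d \<in> polygon_flags (int k)"
  shows "refl1 (int k) d = (0, True) \<longleftrightarrow> d = (1, False)" "refl1 (int k) d = (0, False) \<longleftrightarrow> d = (int k - 1, True)"
    "refl1 (int k) d = (int k - 1, True) \<longleftrightarrow> d = (0, False)"
    "refl1 (int k) d = (int k - 1, False) \<longleftrightarrow> d = (int k - 2, True)"
  using refl1_eq_iff[OF assms(2)] assms(1) by (simp_all add: refl1_values[OF assms(1)])

lemma refl0_eq_iff: "refl0 d = (m, b) \<longleftrightarrow> d = (m, \<not> b)"
  by (cases d) (auto simp: refl0_def)

text \<open>Colour 1 belongs to both pairs and reflects both flags. Each word therefore rotates one
  flag and reflects the other at every step, and the second word may collect
  \<open>hol\<alpha>\<close> as well.\<close>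

lemma moving_cover_rank3:
  fixes s :: "nat \<Rightarrow> 'v \<Rightarrow> 'v"
  assumes V: "involutive_action 3 V s" and fV: "finite V" and x0: "x0 \<in> V"
  obtains Z :: "(('v \<times> (int \<times> bool) \<times> (int \<times> bool)) \<times> nat) set" and sZ y z0 where
    "involutive_action 3 Z sZ" "finite Z" "\<And>z. z \<in> Z \<Longrightarrow> fst (fst z) \<in> V"
    "\<And>i z. fst (fst (sZ i z)) = s i (fst (fst z))" "\<And>i z. i < 3 \<Longrightarrow> z \<in> Z \<Longrightarrow> sZ i z \<noteq> z"
    "\<And>i j z. i < 3 \<Longrightarrow> j < 3 \<Longrightarrow> i \<noteq> j \<Longrightarrow> z \<in> Z \<Longrightarrow> sZ i z \<noteq> sZ j z"
    "y \<in> wrds 3" "z0 \<in> Z" "fold sZ y z0 \<noteq> z0"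
    "\<And>z. z \<in> Z \<Longrightarrow> fold sZ y z \<noteq> z \<Longrightarrow> fst (fst z) = fst (fst z0)"
proof -
  obtain k where k: "k \<ge> 4" "even k" "\<And>x. x \<in> V \<Longrightarrow> ((\<lambda>x. s 1 (s 0 x)) ^^ k) x = x"
    "\<And>x. x \<in> V \<Longrightarrow> ((\<lambda>x. s 2 (s 1 x)) ^^ k) x = x"
    by (rule common_period[OF V fV, of 0 1 1 2]) auto
  let ?k = "int k"
  note rv = refl1_values[OF k(1)]
  define D where "D = flag_act ?k 0 1"
  define E where "E = flag_act ?k 2 1"
  have D: "D 0 = refl0" "D 1 = refl1 ?k" "D (Suc 0) = refl1 ?k" "D 2 = (\<lambda>d. d)"
    and E: "E 0 = (\<lambda>d. d)" "E 1 = refl1 ?k" "E (Suc 0) = refl1 ?k" "E 2 = refl0"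
    by (auto simp: D_def E_def flag_act_def)
  define P where "P = V \<times> polygon_flags ?k \<times> polygon_flags ?k"
  define q where "q = prod_act s D E"
  note involutive_action_prod[OF V involutive_action_flag_act[of 0 1 3 ?k] involutive_action_flag_act[of 2 1 3 ?k]]
  then have a: "involutive_action 3 P q" by (simp add: P_def q_def D_def E_def)
  have q: "q i (x, d, e) = (s i x, D i d, E i e)" for i x d e by (simp add: q_def)
  have fP: "finite P" using fV by (simp add: P_def)
  define c where "c = (x0, (0 :: int, False), (0 :: int, False))"
  have c: "c \<in> P" using x0 k by (simp add: c_def P_def)
  \<comment> \<open>The edge of colour 1 starts at \<open>q 0 c\<close> rather than \<open>c\<close>, so that no cycle of the colours 1 and 2
    meets both kinds of marked edges.\<close>
  define S where "S i = (if i = 1 then {q 0 c} else if i = 2 then {q 1 c, q 0 (q 1 c)} else {})" for i :: nat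
  have S12: "S 1 = {q 0 c}" "S (Suc 0) = {q 0 c}" "S 2 = {q 1 c, q 0 (q 1 c)}" by (simp_all add: S_def)
  have S0: "S 0 = {}" "S 3 = {}" by (simp_all add: S_def)
  have qc: "q 0 c = (s 0 x0, (0, True), (0, False))" "q 1 c = (s 1 x0, (?k - 1, True), (?k - 1, True))"
      "q 0 (q 1 c) = (s 0 (s 1 x0), (?k - 1, False), (?k - 1, True))"
    by (simp_all add: c_def q D E rv)
  have Sx: "S 1 = {(s 0 x0, (0, True), (0, False))}"
      "S 2 = {(s 1 x0, (?k - 1, True), (?k - 1, True)), (s 0 (s 1 x0), (?k - 1, False), (?k - 1, True))}"
      "S (Suc 0) = {(s 0 x0, (0, True), (0, False))}"
    by (simp_all add: S12 qc(1) qc(2)[unfolded One_nat_def] q D E)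
  have three: "i = 0 \<or> i = 1 \<or> i = 2" if "i < 3" for i :: nat using that by auto
  have SP: "S i \<subseteq> P" for i using c involutive_actionD(1)[OF a] by (auto simp: S_def)
  have Sdisj: "q i p \<notin> S i" if "i < 3" "p \<in> S i" for i p
    using three[OF that(1)] that(2) by (auto simp: Sx S0 q D E refl1_def)
  have Sinv: "q j p \<in> S i" if "i < 3" "j < 3" "\<bar>int i - int j\<bar> \<ge> 2" "p \<in> S i" for i j p
    using three[OF that(1)] three[OF that(2)] that(3,4)
      involutive_actionD(2)[OF a, of 0 "q 1 c"] involutive_actionD(1)[OF a _ c]
    by (elim disjE) (auto simp: S12 S0)
  have ref': "refl1 ?k d \<noteq> d" "refl0 d \<noteq> d" for d by (auto simp: refl1_def refl0_def prod_eq_iff)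
  have fp: "q i p \<noteq> p" if "i < 3" "p \<in> P" for i p
    using three[OF that(1)] ref' by (cases p) (auto simp: q D E)
  have ds: "q i p \<noteq> q j p" if ij: "i < 3" "j < 3" "i \<noteq> j" and p: "p \<in> P" for i j p
  proof -
    obtain x d e where xde: "p = (x, d, e)" by (cases p)
    note r = ref'[of d] ref'[of e]
    show ?thesis using three[OF ij(1)] three[OF ij(2)] ij(3) r r[symmetric]
      by (elim disjE) (simp_all add: xde(1) q D E)
  qed
  have n3: "(3::nat) \<le> 4" by simp
  note T = involutive_action_twist[OF a n3 SP S0 Sdisj Sinv]
  let ?T = "twist q S"
  define g1 where "g1 p = q 1 (q 0 p)" for p
  define g2 where "g2 p = q 2 (q 1 p)" for p
  have g1: "(g1 ^^ m) (x, d, e) = (((\<lambda>x. s 1 (s 0 x)) ^^ m) x,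
      ((if snd d then fst d - int m else fst d + int m) mod ?k, snd d), if even m then e else refl1 ?k e)"
    if "d \<in> polygon_flags ?k" "e \<in> polygon_flags ?k" for m x d e
    using funpow_prod_act[where s=s and D=D and E=E and j=1 and i=0 and m=m]
      funpow_refl10[OF that(1), of m] funpow_refl1[OF that(2), of m]
    by (simp add: g1_def[abs_def] q_def D E)
  have g2: "(g2 ^^ m) (x, d, e) = (((\<lambda>x. s 2 (s 1 x)) ^^ m) x, if even m then d else refl1 ?k d,
      ((if snd e then fst e + int m else fst e - int m) mod ?k, snd e))"
    if "d \<in> polygon_flags ?k" "e \<in> polygon_flags ?k" for m x d e
    using funpow_prod_act[where s=s and D=D and E=E and j=2 and i=1 and m=m]
      funpow_refl01[OF that(2), of m] funpow_refl1[OF that(1), of m]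
    by (simp add: g2_def[abs_def] q_def D E)
  have g1P: "g1 p \<in> P" "(g1 ^^ k) p = p" and g2P: "g2 p \<in> P" "(g2 ^^ k) p = p" if "p \<in> P" for p
    using that involutive_actionD(1)[OF a] k(2,3,4) by (auto simp: P_def g1 g2 g1_def g2_def)
  \<comment> \<open>One step of \<open>g2\<close> crosses the edge of colour 1 at \<open>p\<close>
    and then the edge of colour 2 at \<open>q 1 p\<close>. At most one of them is marked for
    \<open>p \<in> P\<close>, so the collected voltage is the non-trivial one, if any.\<close>
  define X2 where "X2 p = (if volt q S 1 p = hol1 then volt q S 2 (q 1 p) else volt q S 1 p)" for p
  define C1 where "C1 = {p \<in> P. fst (snd p) \<in> {(0, False), (1, True)}}"
  \<comment> \<open>The first two pairs of flags belong to the marked edge of colour 1, read from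
    its two ends; the other four belong to the two marked edges of colour 2, likewise, pulled back
    along colour 1.\<close>
  define C2 where "C2 = {p \<in> P. snd p \<in> {((0, True), (0, False)), ((1, False), (?k - 1, True)),
    ((0, False), (0, False)), ((?k - 2, True), (0, False)),
    ((0, False), (?k - 2, True)), ((?k - 2, True), (?k - 2, True))}}"
  have v1: "volt q S 1 p \<noteq> hol1 \<Longrightarrow> (d, e) \<in> {((0, True), (0, False)), ((1, False), (?k - 1, True))}"
    and v1': "volt q S 1 (q 0 p) \<noteq> hol1 \<Longrightarrow> d \<in> {(0, False), (1, True)}"
    and v2: "volt q S 2 (q 1 p) \<noteq> hol1 \<Longrightarrow> (d, e) \<in> {((0, False), (0, False)), ((?k - 2, True), (0, False)),
      ((0, False), (?k - 2, True)), ((?k - 2, True), (?k - 2, True))}"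
    if "p = (x, d, e)" "d \<in> polygon_flags ?k" "e \<in> polygon_flags ?k" for p x d e
  proof -
    note r = refl1_eq_values[OF k(1) that(2)] refl1_eq_values[OF k(1) that(3)]
    note r0 = refl1_eq_values[OF k(1) refl0_in[OF that(2)]]
    note q1 = q[of 0] q[of 1] q[of 2] q[of 1, unfolded One_nat_def]
    show "(d, e) \<in> {((0, True), (0, False)), ((1, False), (?k - 1, True))}" if "volt q S 1 p \<noteq> hol1"
    proof -
      have "p \<in> S 1 \<or> q 1 p \<in> S 1" using volt_eq_hol1[of p S 1 q] that by metis
      then show ?thesis using \<open>p = _\<close> by (auto simp: Sx q1 D E r)
    qed
    show "d \<in> {(0, False), (1, True)}" if "volt q S 1 (q 0 p) \<noteq> hol1"
    proof -
      have "q 0 p \<in> S 1 \<or> q 1 (q 0 p) \<in> S 1" using volt_eq_hol1[of "q 0 p" S 1 q] that by metis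
      then show ?thesis using \<open>p = _\<close> by (auto simp: Sx q1 D E r0 refl0_eq_iff)
    qed
    show "(d, e) \<in> {((0, False), (0, False)), ((?k - 2, True), (0, False)),
      ((0, False), (?k - 2, True)), ((?k - 2, True), (?k - 2, True))}" if "volt q S 2 (q 1 p) \<noteq> hol1"
    proof -
      have "q 1 p \<in> S 2 \<or> q 2 (q 1 p) \<in> S 2" using volt_eq_hol1[of "q 1 p" S 2 q] that by metis
      then show ?thesis using \<open>p = _\<close> by (auto simp: Sx q1 D E r refl0_eq_iff)
    qed
  qed
  have C1: "volt q S 1 (q 0 p) = hol1" if "p \<in> P" "p \<notin> C1" for p
    using v1'[of p] that by (cases p) (auto simp: C1_def P_def)
  have v12: "p \<notin> C2 \<Longrightarrow> volt q S 1 p = hol1" "p \<notin> C2 \<Longrightarrow> volt q S 2 (q 1 p) = hol1"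
      "volt q S 1 p = hol1 \<or> volt q S 2 (q 1 p) = hol1" if "p \<in> P" for p
  proof -
    obtain x d e where p: "p = (x, d, e)" by (cases p)
    have de: "d \<in> polygon_flags ?k" "e \<in> polygon_flags ?k" using that by (simp_all add: P_def p)
    note v1 = v1[OF p de] and v2 = v2[OF p de]
    show "volt q S 1 p = hol1" if "p \<notin> C2"
    proof (rule ccontr)
      assume "volt q S 1 p \<noteq> hol1"
      from v1[OF this] have "p \<in> C2" using \<open>p \<in> P\<close> by (auto simp: C2_def p)
      then show False using that by simp
    qed
    show "volt q S 2 (q 1 p) = hol1" if "p \<notin> C2"
    proof (rule ccontr)
      assume "volt q S 2 (q 1 p) \<noteq> hol1"
      from v2[OF this] have "p \<in> C2" using \<open>p \<in> P\<close> by (auto simp: C2_def p)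
      then show False using that by simp
    qed
    show "volt q S 1 p = hol1 \<or> volt q S 2 (q 1 p) = hol1"
    proof (rule ccontr)
      assume "\<not> ?thesis"
      then have "volt q S 1 p \<noteq> hol1" "volt q S 2 (q 1 p) \<noteq> hol1" by blast+
      from v1[OF this(1)] v2[OF this(2)] show False using k(1) by auto
    qed
  qed
  have C2: "X2 p = hol1" if "p \<in> P" "p \<notin> C2" for p
    using v12(1,2)[OF that] by (simp only: X2_def if_cancel)
  note excl = v12(3)
  have C1': "(g1 ^^ m) p \<notin> C1" if "p \<in> C1" "0 < m" "m < k" for p m
    using that(1) mod_shift_ne[OF that(2,3), of 0] mod_shift_ne[OF that(2,3), of 1] k(1)
    by (auto simp: C1_def P_def g1)
  \<comment> \<open>Of the second flags in \<open>C2\<close> only \<open>(?k - 1, True)\<close> and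
    \<open>(?k - 2, True)\<close> can be rotated into each other. From the former to the latter
    takes \<open>k - 1\<close> steps, an odd number since \<open>k\<close> is even, so the first
    flag \<open>(1, False)\<close> becomes \<open>(0, True)\<close>. The way back takes one step and
    gives a first flag with number \<open>?k - 1\<close>, not \<open>(1, False)\<close>. Neither
    result is listed.\<close>
  have C2': "(g2 ^^ m) p \<notin> C2" if "p \<in> C2" "0 < m" "m < k" for p m
  proof -
    have "(?k - 1 + int m) mod ?k = (int m - 1 + ?k) mod ?k" by (simp only: algebra_simps)
    also have "\<dots> = (int m - 1) mod ?k" by (rule mod_add_self2)
    also have "\<dots> = int m - 1" by (rule mod_pos_pos_trivial) (use that in auto)
    finally have 1: "(?k - 1 + int m) mod ?k = int m - 1" .
    have "(?k - 2 + int m) mod ?k = (int m - 2 + ?k) mod ?k" by (simp only: algebra_simps)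
    also have "\<dots> = (int m - 2) mod ?k" by (rule mod_add_self2)
    also have "\<dots> = (if m = 1 then ?k - 1 else int m - 2)"
      using zmod_minus1[of ?k] mod_pos_pos_trivial[of "int m - 2" ?k] that(2,3) k(1) by auto
    finally have 2: "(?k - 2 + int m) mod ?k = (if m = 1 then ?k - 1 else int m - 2)" .
    have 3: "(- int m) mod ?k \<noteq> 0" using mod_shift_ne(2)[OF that(2,3), of 0] by simp
    have 4: "int m - 1 \<noteq> ?k - 1" "int m - 2 \<noteq> ?k - 2" "int m - 2 \<noteq> ?k - 1" using that by auto
    have 5: "odd m" if "int m - 1 = ?k - 2"
    proof -
      have "m + 1 = k" using that by linarith
      then show ?thesis using k(2) by (metis even_plus_one_iff)
    qed
    obtain x d e where p: "p = (x, d, e)" by (cases p)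
    have de: "d \<in> polygon_flags ?k" "e \<in> polygon_flags ?k" using that(1) by (auto simp: C2_def P_def p)
    have "(d, e) \<in> {((0, True), (0, False)), ((1, False), (?k - 1, True)),
      ((0, False), (0, False)), ((?k - 2, True), (0, False)),
      ((0, False), (?k - 2, True)), ((?k - 2, True), (?k - 2, True))}"
      using that(1) by (simp add: C2_def p)
    then show ?thesis using 3 4 5 k(1) unfolding p g2[OF de] C2_def
      by (elim insertE emptyE) (auto simp: 1 2 rv split: if_splits)
  qed
  have h1: "?T 1 (?T 0 (p, t)) = (g1 p, aff (fst (volt q S 1 (q 0 p))) t)" if "t < 5" for p t
  proof -
    have "volt q S 0 p = hol1" using S0 by (simp add: volt_eq_hol1)
    then show ?thesis using that by (simp add: twist_def g1_def hol1_def aff_one[simplified])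
  qed
  have h2: "?T 2 (?T 1 (p, t)) = (g2 p, aff (fst (X2 p)) t)" if "p \<in> P" "t < 5" for p t
    using excl[OF that(1)] that(2)
    by (auto simp: twist_def g2_def X2_def hol1_def aff_one[simplified])
  have X2_cases: "X2 p \<in> {hol1, hol\<alpha>, prod.swap hol\<alpha>, hol\<beta>, prod.swap hol\<beta>}" for p
    using volt_cases[of q S 1 p] volt_cases[of q S 2 "q 1 p"] unfolding X2_def by presburger
  have X2_\<beta>: "q 1 p \<in> S 2" if "X2 p = hol\<beta>" for p
  proof -
    have "volt q S 1 p \<noteq> hol\<beta>" using volt_1(1)[of q S p] hol_distinct by auto
    then have "volt q S 2 (q 1 p) = hol\<beta>" using that unfolding X2_def by presburger
    then show ?thesis using volt_2(2)[of q S "q 1 p"] by blast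
  qed
  let ?y1 = "concat (replicate k [0, 1])" and ?y2 = "concat (replicate k [1, 2])"
  have lt1: "0 < (3::nat)" "1 < (3::nat)" and lt2: "1 < (3::nat)" "2 < (3::nat)" by simp_all
  have ha1: "holonomy ?T p ?y1 hol1 \<or> (\<exists>m<k. (g1 ^^ m) p \<in> C1 \<and> holonomy ?T p ?y1 (volt q S 1 (q 0 ((g1 ^^ m) p))))"
    if p: "p \<in> P" for p
    using T lt1 h1 volt_cases g1P C1 C1' p by (rule holonomy_alternating(1))
  have hb1: "holonomy ?T p ?y1 (volt q S 1 (q 0 ((g1 ^^ m) p)))"
    if p: "p \<in> P" and m: "m < k" "(g1 ^^ m) p \<in> C1" for p m
    using T lt1 h1 volt_cases g1P C1 C1' p m by (rule holonomy_alternating(2))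
  have ha2: "holonomy ?T p ?y2 hol1 \<or> (\<exists>m<k. (g2 ^^ m) p \<in> C2 \<and> holonomy ?T p ?y2 (X2 ((g2 ^^ m) p)))"
    if p: "p \<in> P" for p
    using T lt2 h2 X2_cases g2P C2 C2' p by (rule holonomy_alternating(1))
  have hb2: "holonomy ?T p ?y2 (X2 ((g2 ^^ m) p))"
    if p: "p \<in> P" and m: "m < k" "(g2 ^^ m) p \<in> C2" for p m
    using T lt2 h2 X2_cases g2P C2 C2' p m by (rule holonomy_alternating(2))
  have "c \<in> C1" "c \<in> C2" using c by (auto simp: C1_def C2_def c_def)
  moreover have "volt q S 1 (q 0 c) = hol\<alpha>" by (simp add: volt_1(2)[simplified] S12)
  moreover have "volt q S 2 (q 1 c) = hol\<beta>" using volt_2(2)[of q S "q 1 c"] by (simp add: S12)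
  moreover from this have "X2 c = hol\<beta>" using excl[OF c] hol_distinct by (auto simp: X2_def)
  ultimately have hc: "holonomy ?T c ?y1 hol\<alpha>" "holonomy ?T c ?y2 hol\<beta>"
    using hb1[OF c, of 0] hb2[OF c, of 0] k(1) by auto
  \<comment> \<open>The mark of colour 2 requires the Boolean of \<open>e\<close> to be
    \<open>False\<close>, and then the mark of colour 1 leaves only \<open>e = (0, False)\<close>.
    Hence \<open>m' = 0\<close>. The two points of \<open>S 2\<close> differ in the Boolean of the
    first flag, which the mark of colour 1 determines.\<close>
  have isolate: "p = c" if p: "p \<in> P" and 1: "m < k" "q 0 ((g1 ^^ m) p) \<in> S 1" and 2: "m' < k" "q 1 ((g2 ^^ m') p) \<in> S 2" for p m m'
  proof -
    obtain x d e where xde: "p = (x, d, e)" "d \<in> polygon_flags ?k" "e \<in> polygon_flags ?k"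
      using p by (auto simp: P_def)
    have "snd d = False" "(if even m then e else refl1 ?k e) = (0, False)"
      using 1(2) by (auto simp: xde(1) g1[OF xde(2,3)] Sx q D E)
    moreover have "refl1 ?k ((if snd e then fst e + int m' else fst e - int m') mod ?k, snd e) = (?k - 1, True)"
      using 2(2) by (auto simp: xde(1) g2[OF xde(2,3)] Sx q D E)
    ultimately have e: "snd d = False" "e = (0, False)" "(- int m') mod ?k = 0"
      using refl1_eq_iff[of "((- int m') mod ?k, False)" ?k "(?k - 1, True)"] k(1)
      by (auto simp: refl1_def rv split: if_splits)
    then have m': "m' = 0" using mod_shift_ne(2)[of m' k 0] 2(1) by (cases "m' = 0") auto
    have "q 1 p \<in> {q 1 c, q 0 (q 1 c)}" using 2(2) m' S12 by simp
    moreover have "q 1 p \<noteq> q 0 (q 1 c)" using e(1) unfolding qc by (auto simp: xde(1) q D refl1_def)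
    ultimately have "q 1 (q 1 p) = q 1 (q 1 c)" by simp
    then show ?thesis using involutive_actionD(2)[OF a, of 1] p c by simp
  qed
  have main: "\<exists>A B. A \<in> {hol1, hol\<alpha>, prod.swap hol\<alpha>} \<and>
      B \<in> {hol1, hol\<alpha>, prod.swap hol\<alpha>, hol\<beta>, prod.swap hol\<beta>} \<and>
      holonomy ?T p ?y1 A \<and> holonomy ?T p ?y2 B \<and> (A = hol\<alpha> \<longrightarrow> B = hol\<beta> \<longrightarrow> p = c)" if p: "p \<in> P" for p
  proof -
    obtain A where A: "A \<in> {hol1, hol\<alpha>, prod.swap hol\<alpha>}" "holonomy ?T p ?y1 A"
        "A = hol\<alpha> \<longrightarrow> (\<exists>m<k. q 0 ((g1 ^^ m) p) \<in> S 1)"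
      using ha1[OF p] volt_1 hol_distinct by (metis insertI1)
    obtain B where B: "B \<in> {hol1, hol\<alpha>, prod.swap hol\<alpha>, hol\<beta>, prod.swap hol\<beta>}" "holonomy ?T p ?y2 B"
        "B = hol\<beta> \<longrightarrow> (\<exists>m<k. q 1 ((g2 ^^ m) p) \<in> S 2)"
      using ha2[OF p] X2_cases X2_\<beta> hol_distinct by (metis insertI1)
    show ?thesis using A B isolate[OF p] by blast
  qed
  have y: "?y1 \<in> wrds 3" "?y2 \<in> wrds 3" by (rule alternating_in_wrds; simp)+
  show thesis using a fP n3 SP S0 Sdisj Sinv fp ds c y hc main
  proof (rule twist_cover)
    fix Z :: "(('v \<times> (int \<times> bool) \<times> (int \<times> bool)) \<times> nat) set" and sZ y z0
    assume Z: "involutive_action 3 Z sZ" "finite Z" "Z \<subseteq> P \<times> UNIV"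
      "\<And>i z. fst (sZ i z) = q i (fst z)" "\<And>i z. i < 3 \<Longrightarrow> z \<in> Z \<Longrightarrow> sZ i z \<noteq> z"
      "\<And>i j z. i < 3 \<Longrightarrow> j < 3 \<Longrightarrow> i \<noteq> j \<Longrightarrow> z \<in> Z \<Longrightarrow> sZ i z \<noteq> sZ j z"
      "y \<in> wrds 3" "z0 \<in> Z" "fold sZ y z0 \<noteq> z0"
      "\<And>z. z \<in> Z \<Longrightarrow> fold sZ y z \<noteq> z \<Longrightarrow> fst z = fst z0"
    show thesis
    proof (rule that)
      show "fst (fst z) \<in> V" if "z \<in> Z" for z using Z(3) that by (auto simp: P_def)
      show "fst (fst (sZ i z)) = s i (fst (fst z))" for i z by (simp add: Z(4) q_def prod_act_def)
      show "fst (fst z) = fst (fst z0)" if "z \<in> Z" "fold sZ y z \<noteq> z" for z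
        using Z(10)[OF that] by simp
    qed (use Z in simp_all)
  qed
qed

section \<open>Renumbering the vertices of the cover\<close>

lemma involutive_action_transport:
  assumes e: "bij_betw e U S" and U: "involutive_action n U t"
  shows "involutive_action n S (\<lambda>i x. e (t i (inv_into U e x)))"
  unfolding involutive_action_def
  using involutive_actionD[OF U] involutive_action_commute[OF U] bij_betw_inv_into_left[OF e]
    bij_betw_inv_into_right[OF e] bij_betwE[OF e] bij_betwE[OF bij_betw_inv_into[OF e]]
  by simp

lemma covering_action:
  fixes s :: "nat \<Rightarrow> 'v \<Rightarrow> 'v"
  assumes n: "n \<in> {3, 4}" and V: "involutive_action n V s" "transitive_action n V s"
    and fV: "finite V" "V \<noteq> {}"
    and E: "equiv V E" "\<And>i x x'. i < n \<Longrightarrow> (x, x') \<in> E \<Longrightarrow> (s i x, s i x') \<in> E"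
  obtains m :: nat and t \<pi> where "m > 0" "involutive_action n {..<m} t" "transitive_action n {..<m} t"
    "\<And>u. u < m \<Longrightarrow> \<pi> u \<in> V" "\<And>i u. i < n \<Longrightarrow> u < m \<Longrightarrow> \<pi> (t i u) = s i (\<pi> u)"
    "\<And>i u. i < n \<Longrightarrow> u < m \<Longrightarrow> t i u \<noteq> u"
    "\<And>i j u. i < n \<Longrightarrow> j < n \<Longrightarrow> i \<noteq> j \<Longrightarrow> u < m \<Longrightarrow> t i u \<noteq> t j u"
    "\<And>u u'. u < m \<Longrightarrow> u' < m \<Longrightarrow> word_stab n t u = word_stab n t u' \<longleftrightarrow> (\<pi> u, \<pi> u') \<in> E"
proof -
  obtain x0 where x0: "x0 \<in> V" using fV by blast
  obtain Z :: "(('v \<times> (int \<times> bool) \<times> (int \<times> bool)) \<times> nat) set" and sZ y z0 where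
    Z: "involutive_action n Z sZ" "finite Z" "\<And>z. z \<in> Z \<Longrightarrow> fst (fst z) \<in> V"
    "\<And>i z. fst (fst (sZ i z)) = s i (fst (fst z))" "\<And>i z. i < n \<Longrightarrow> z \<in> Z \<Longrightarrow> sZ i z \<noteq> z"
    "\<And>i j z. i < n \<Longrightarrow> j < n \<Longrightarrow> i \<noteq> j \<Longrightarrow> z \<in> Z \<Longrightarrow> sZ i z \<noteq> sZ j z"
    "y \<in> wrds n" "z0 \<in> Z" "fold sZ y z0 \<noteq> z0"
    "\<And>z. z \<in> Z \<Longrightarrow> fold sZ y z \<noteq> z \<Longrightarrow> fst (fst z) = fst (fst z0)"
  proof (cases "n = 3")
    case True
    show thesis using V(1) fV(1) x0 unfolding True
      by (rule moving_cover_rank3) (rule that[unfolded True])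
  next
    case False
    then have 4: "n = 4" using n by simp
    show thesis using V(1) fV(1) x0 unfolding 4
      by (rule moving_cover_rank4) (rule that[unfolded 4])
  qed
  show thesis using V fV(1) Z(1,2,3,4,5,6,7,8,9,10) E
  proof (rule separating_action[where \<rho> = "\<lambda>z. fst (fst z)"])
    fix U :: "('v \<times> (('v \<times> (int \<times> bool) \<times> (int \<times> bool)) \<times> nat) list) set" and t
    assume U: "finite U" "U \<noteq> {}" "involutive_action n U t" "transitive_action n U t"
      "\<And>u. u \<in> U \<Longrightarrow> fst u \<in> V" "\<And>i u. i < n \<Longrightarrow> u \<in> U \<Longrightarrow> fst (t i u) = s i (fst u)"
      "\<And>i u. i < n \<Longrightarrow> u \<in> U \<Longrightarrow> t i u \<noteq> u"
      "\<And>i j u. i < n \<Longrightarrow> j < n \<Longrightarrow> i \<noteq> j \<Longrightarrow> u \<in> U \<Longrightarrow> t i u \<noteq> t j u"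
      "\<And>u u'. u \<in> U \<Longrightarrow> u' \<in> U \<Longrightarrow> word_stab n t u = word_stab n t u' \<longleftrightarrow> (fst u, fst u') \<in> E"
    let ?m = "card U"
    obtain e where e: "bij_betw e U {..<?m}"
      using ex_bij_betw_finite_nat[OF U(1)] by (auto simp: atLeast0LessThan)
    define e' where "e' = inv_into U e"
    define t' where "t' i x = e (t i (e' x))" for i x
    have e': "e' x \<in> U" "e (e' x) = x" if "x < ?m" for x
      using that bij_betw_inv_into_right[OF e] bij_betwE[OF bij_betw_inv_into[OF e]] by (simp_all add: e'_def)
    have ee: "e u < ?m" "e' (e u) = u" if "u \<in> U" for u
      using that bij_betw_inv_into_left[OF e] bij_betwE[OF e] by (auto simp: e'_def)
    have t': "involutive_action n {..<?m} t'"
      unfolding t'_def e'_def by (rule involutive_action_transport[OF e U(3)])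
    have te: "t' i (e u) = e (t i u)" if "u \<in> U" for i u using ee[OF that] by (simp add: t'_def)
    have f: "fold t' w (e u) = e (fold t w u)" if "w \<in> wrds n" "u \<in> U" for w u
      using fold_equivariant[of n U e t t'] te involutive_actionD(1)[OF U(3)] that by metis
    have eq: "e u = e u' \<longleftrightarrow> u = u'" if "u \<in> U" "u' \<in> U" for u u' using ee that by metis
    have st: "word_stab n t' (e u) = word_stab n t u" if "u \<in> U" for u
      unfolding word_stab_def using f[OF _ that] eq[OF fold_in[OF U(3) _ that] that] by auto
    show thesis
    proof (rule that)
      show "card U > 0" using U(1,2) by (simp add: card_gt_0_iff)
      show "involutive_action n {..<?m} t'" by (rule t')
      show "transitive_action n {..<?m} t'"
        unfolding transitive_action_def
      proof (intro ballI)
        fix x y assume "x \<in> {..<?m}" "y \<in> {..<?m}"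
        then have xy: "x < ?m" "y < ?m" by auto
        obtain w where "w \<in> wrds n" "fold t w (e' x) = e' y"
          using U(4) e'(1)[OF xy(1)] e'(1)[OF xy(2)] unfolding transitive_action_def by blast
        then show "\<exists>w\<in>wrds n. fold t' w x = y" using f[OF _ e'(1)[OF xy(1)]] e' xy by force
      qed
      show "fst (e' u) \<in> V" if "u < ?m" for u using U(5) e'(1)[OF that] by blast
      show "fst (e' (t' i u)) = s i (fst (e' u))" if "i < n" "u < ?m" for i u
        using U(6)[OF that(1) e'(1)[OF that(2)]] ee involutive_actionD(1)[OF U(3) that(1) e'(1)[OF that(2)]]
        by (simp add: t'_def)
      show "t' i u \<noteq> u" if "i < n" "u < ?m" for i u
        using U(7)[OF that(1) e'(1)[OF that(2)]] ee(2)[OF involutive_actionD(1)[OF U(3) that(1) e'(1)[OF that(2)]]]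
        by (auto simp: t'_def)
      show "t' i u \<noteq> t' j u" if "i < n" "j < n" "i \<noteq> j" "u < ?m" for i j u
        using U(8)[OF that(1-3) e'(1)[OF that(4)]]
          eq[OF involutive_actionD(1)[OF U(3) that(1) e'(1)[OF that(4)]] involutive_actionD(1)[OF U(3) that(2) e'(1)[OF that(4)]]]
        by (simp add: t'_def)
      show "word_stab n t' u = word_stab n t' u' \<longleftrightarrow> (fst (e' u), fst (e' u')) \<in> E" if "u < ?m" "u' < ?m" for u u'
        using U(9)[OF e'(1)[OF that(1)] e'(1)[OF that(2)]] st[OF e'(1)[OF that(1)]] st[OF e'(1)[OF that(2)]] e' that
        by simp
    qed
  qed
qed

section \<open>Premaniplexes and actions\<close>

lemma carrier_AutCGraph: "carrier (AutCGraph X) = cgraph_auto X"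
  by (simp add: AutCGraph_def)

definition dart_of :: "('v, 'd, 'm) cgraph_scheme \<Rightarrow> 'v \<Rightarrow> nat \<Rightarrow> 'd" where
  "dart_of X v i = (THE x. x \<in> darts_at X v \<and> colour X x = i)"

definition nbr :: "('v, 'd, 'm) cgraph_scheme \<Rightarrow> nat \<Rightarrow> 'v \<Rightarrow> 'v" where
  "nbr X i v = beg X (dinv X (dart_of X v i))"

locale premaniplex_graph =
  fixes n :: nat and X :: "('v, 'd, 'm) cgraph_scheme"
  assumes premaniplex: "premaniplex n X"
begin

lemma is_dgraph: "is_dgraph X"
  using premaniplex by (simp add: premaniplex_def connected_dgraph_def)

lemma dartD:
  assumes "x \<in> darts X"
  shows "beg X x \<in> verts X" "dinv X x \<in> darts X" "dinv X (dinv X x) = x"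
    "colour X x < n" "colour X (dinv X x) = colour X x"
  using is_dgraph premaniplex assms by (auto simp: is_dgraph_def premaniplex_def edge_coloured_def)

lemma ex1_dart: "v \<in> verts X \<Longrightarrow> i < n \<Longrightarrow> \<exists>!x. x \<in> darts_at X v \<and> colour X x = i"
  using premaniplex unfolding premaniplex_def by blast

lemma dart_of:
  assumes "v \<in> verts X" "i < n"
  shows "dart_of X v i \<in> darts X" "beg X (dart_of X v i) = v" "colour X (dart_of X v i) = i"
  using theI'[OF ex1_dart[OF assms]] by (auto simp: dart_of_def darts_at_def)

lemma dart_of_eq:
  assumes "x \<in> darts X"
  shows "dart_of X (beg X x) (colour X x) = x"
  unfolding dart_of_def
  by (rule the1_equality[OF ex1_dart]) (use dartD[OF assms] assms in \<open>auto simp: darts_at_def\<close>)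

lemma nbr_in: "v \<in> verts X \<Longrightarrow> i < n \<Longrightarrow> nbr X i v \<in> verts X"
  using dartD dart_of by (simp add: nbr_def)

lemma dinv_dart_of:
  assumes "v \<in> verts X" "i < n"
  shows "dinv X (dart_of X v i) = dart_of X (nbr X i v) i"
  using dart_of_eq[OF dartD(2)[OF dart_of(1)[OF assms]]] dartD(5)[OF dart_of(1)[OF assms]]
    dart_of(3)[OF assms] by (simp add: nbr_def)

lemma nbr_nbr:
  assumes "v \<in> verts X" "i < n"
  shows "nbr X i (nbr X i v) = v"
  using dinv_dart_of[OF assms] dartD(3)[OF dart_of(1)[OF assms]] dart_of(2)[OF assms]
  unfolding nbr_def[of X i "nbr X i v"] by simp

lemma walk_colours: "walk X u xs v \<Longrightarrow> map (colour X) xs \<in> wrds n \<and> fold (nbr X) (map (colour X) xs) u = v"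
proof (induction xs arbitrary: u)
  case (Cons x xs)
  have "nbr X (colour X x) u = beg X (dinv X x)"
    using Cons.prems dart_of_eq[of x] by (auto simp: nbr_def)
  then show ?case using Cons dartD(4)[of x] by auto
qed simp

lemma ex_walk: "w \<in> wrds n \<Longrightarrow> u \<in> verts X \<Longrightarrow> \<exists>xs. walk X u xs (fold (nbr X) w u) \<and> map (colour X) xs = w"
proof (induction w arbitrary: u)
  case (Cons i w)
  then have i: "i < n" and u: "u \<in> verts X" by simp_all
  obtain xs where "walk X (nbr X i u) xs (fold (nbr X) w (nbr X i u))" "map (colour X) xs = w"
    using Cons.IH[of "nbr X i u"] Cons.prems nbr_in[OF u i] by auto
  then show ?case using dart_of[OF u i] by (intro exI[of _ "dart_of X u i # xs"]) (simp flip: nbr_def)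
qed simp

lemma involutive_action_nbr: "involutive_action n (verts X) (nbr X)"
  unfolding involutive_action_def
proof (intro conjI allI impI ballI)
  fix i j v assume ij: "i < n" "j < n" "\<bar>int i - int j\<bar> \<ge> 2" and v: "v \<in> verts X"
  have "[i, j, i, j] \<in> wrds n" using ij by simp
  from ex_walk[OF this v]
  obtain xs where xs: "walk X v xs (fold (nbr X) [i, j, i, j] v)" "map (colour X) xs = [i, j, i, j]"
    by (elim exE conjE)
  have "\<forall>i<n. \<forall>j<n. \<bar>int i - int j\<bar> \<ge> 2 \<longrightarrow>
        (\<forall>u v xs. walk X u xs v \<and> map (colour X) xs = [i, j, i, j] \<longrightarrow> u = v)"
    using premaniplex unfolding premaniplex_def by (elim conjE)
  from this[rule_format, OF ij conjI[OF xs]] have "nbr X j (nbr X i (nbr X j (nbr X i v))) = v" by simp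
  then have "nbr X i (nbr X j (nbr X j (nbr X i (nbr X j (nbr X i v))))) = nbr X i (nbr X j v)" by simp
  then show "nbr X i (nbr X j v) = nbr X j (nbr X i v)" using ij v by (simp add: nbr_nbr nbr_in)
qed (simp_all add: nbr_in nbr_nbr)

lemma transitive_action_nbr: "transitive_action n (verts X) (nbr X)"
  unfolding transitive_action_def
proof (intro ballI)
  fix u v assume "u \<in> verts X" "v \<in> verts X"
  then obtain xs where "walk X u xs v" using premaniplex unfolding premaniplex_def connected_dgraph_def by blast
  then show "\<exists>w\<in>wrds n. fold (nbr X) w u = v" using walk_colours by blast
qed

text \<open>Connectivity as an induction principle: an identity between equivariant maps has to be
  checked at a single vertex.\<close>

lemma vertex_induct:
  assumes "u \<in> verts X" "Q u" "\<And>v i. v \<in> verts X \<Longrightarrow> i < n \<Longrightarrow> Q v \<Longrightarrow> Q (nbr X i v)" "v \<in> verts X"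
  shows "Q v"
proof -
  obtain w where w: "w \<in> wrds n" "fold (nbr X) w u = v"
    using transitive_action_nbr assms(1,4) unfolding transitive_action_def by blast
  have "x \<in> verts X \<Longrightarrow> Q x \<Longrightarrow> w \<in> wrds n \<Longrightarrow> Q (fold (nbr X) w x)" for w x
    by (induction w arbitrary: x) (simp_all add: assms(3) nbr_in)
  then show ?thesis using assms(1,2) w by blast
qed

end

section \<open>Morphisms as equivariant vertex maps\<close>

text \<open>A colour-preserving morphism between premaniplexes is determined by its vertex map.\<close>

definition induced_darts :: "('w, 'e, 'k) cgraph_scheme \<Rightarrow> ('v, 'd, 'm) cgraph_scheme \<Rightarrow> ('w \<Rightarrow> 'v) \<Rightarrow> 'e \<Rightarrow> 'd" where
  "induced_darts M X f y = dart_of X (f (beg M y)) (colour M y)"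

locale two_premaniplexes = M: premaniplex_graph n M + X: premaniplex_graph n X
  for n :: nat and M :: "('w, 'e, 'k) cgraph_scheme" and X :: "('v, 'd, 'm) cgraph_scheme"
begin

lemma hom_nbr:
  assumes "(f, g) \<in> dgraph_hom M X" "colour_preserving M X (f, g)"
  shows "v \<in> verts M \<Longrightarrow> f v \<in> verts X" "y \<in> darts M \<Longrightarrow> g y = induced_darts M X f y"
    "v \<in> verts M \<Longrightarrow> i < n \<Longrightarrow> f (nbr M i v) = nbr X i (f v)"
proof -
  show "f v \<in> verts X" if "v \<in> verts M" for v using assms that by (auto simp: dgraph_hom_def)
  show g: "g y = induced_darts M X f y" if y: "y \<in> darts M" for y
  proof -
    have "g y \<in> darts X" "beg X (g y) = f (beg M y)" "colour X (g y) = colour M y"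
      using assms y by (auto simp: dgraph_hom_def colour_preserving_def)
    then show ?thesis using X.dart_of_eq[of "g y"] by (simp add: induced_darts_def)
  qed
  assume v: "v \<in> verts M" "i < n"
  show "f (nbr M i v) = nbr X i (f v)"
  proof -
    have h: "beg X (g y) = f (beg M y)" "dinv X (g y) = g (dinv M y)" if "y \<in> darts M" for y
      using assms that by (auto simp: dgraph_hom_def)
    note d = M.dart_of[OF v]
    have "dart_of X (f v) i = g (dart_of M v i)" using g[OF d(1)] d by (simp add: induced_darts_def)
    then show ?thesis using h[OF d(1)] h(1)[OF M.dartD(2)[OF d(1)]] by (simp add: nbr_def)
  qed
qed

lemma induced_hom:
  assumes "\<And>v. v \<in> verts M \<Longrightarrow> f v \<in> verts X"
    "\<And>i v. v \<in> verts M \<Longrightarrow> i < n \<Longrightarrow> f (nbr M i v) = nbr X i (f v)"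
  shows "(f, induced_darts M X f) \<in> dgraph_hom M X" "colour_preserving M X (f, induced_darts M X f)"
proof -
  have "induced_darts M X f y \<in> darts X \<and> beg X (induced_darts M X f y) = f (beg M y) \<and>
      dinv X (induced_darts M X f y) = induced_darts M X f (dinv M y) \<and>
      colour X (induced_darts M X f y) = colour M y" if y: "y \<in> darts M" for y
  proof -
    note d = M.dartD[OF y]
    have "beg M (dinv M y) = nbr M (colour M y) (beg M y)" by (simp add: nbr_def M.dart_of_eq[OF y])
    then show ?thesis
      using d assms X.dart_of[of "f (beg M y)" "colour M y"] X.dinv_dart_of[of "f (beg M y)" "colour M y"]
      by (simp add: induced_darts_def)
  qed
  then show "(f, induced_darts M X f) \<in> dgraph_hom M X" "colour_preserving M X (f, induced_darts M X f)"
    using assms(1) by (auto simp: dgraph_hom_def colour_preserving_def)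
qed

text \<open>Equivariance alone suffices: connectivity of the target gives surjectivity, and the
  unique dart of each colour at every vertex gives bijectivity on the darts at a vertex.\<close>

lemma induced_covering:
  assumes f: "\<And>v. v \<in> verts M \<Longrightarrow> f v \<in> verts X"
    "\<And>i v. v \<in> verts M \<Longrightarrow> i < n \<Longrightarrow> f (nbr M i v) = nbr X i (f v)"
  shows "covering_projection M X (f, induced_darts M X f)"
proof -
  note h = induced_hom[OF f]
  obtain u where u: "u \<in> verts M" using M.is_dgraph by (auto simp: is_dgraph_def)
  have "v \<in> f ` verts M" if "v \<in> verts X" for v
  proof (rule X.vertex_induct[OF f(1)[OF u] _ _ that])
    show "f u \<in> f ` verts M" using u by blast
    show "nbr X i v \<in> f ` verts M" if "i < n" "v \<in> f ` verts M" for v i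
    proof -
      from that(2) obtain x where "x \<in> verts M" "v = f x" by blast
      then show ?thesis using f(2)[OF _ that(1), of x] M.nbr_in[OF _ that(1), of x] by (metis imageI)
    qed
  qed
  then have im: "f ` verts M = verts X" using f(1) by blast
  have bij: "bij_betw (induced_darts M X f) (darts_at M u) (darts_at X (f u))" if u: "u \<in> verts M" for u
  proof (rule bij_betwI')
    fix x y assume xy: "x \<in> darts_at M u" "y \<in> darts_at M u"
    show "induced_darts M X f x = induced_darts M X f y \<longleftrightarrow> x = y"
    proof
      assume "induced_darts M X f x = induced_darts M X f y"
      then have "colour M x = colour M y" using xy h(2) by (auto simp: darts_at_def colour_preserving_def) metis
      then show "x = y" using xy M.dart_of_eq[of x] M.dart_of_eq[of y] by (simp add: darts_at_def)
    qed simp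
  next
    fix x assume "x \<in> darts_at M u"
    then show "induced_darts M X f x \<in> darts_at X (f u)" using h(1) by (auto simp: darts_at_def dgraph_hom_def)
  next
    fix y assume y: "y \<in> darts_at X (f u)"
    then have y': "y \<in> darts X" "beg X y = f u" by (auto simp: darts_at_def)
    note d = M.dart_of[OF u X.dartD(4)[OF y'(1)]]
    have "y = induced_darts M X f (dart_of M u (colour X y))"
      using d X.dart_of_eq[OF y'(1)] y'(2) by (simp add: induced_darts_def)
    then show "\<exists>x\<in>darts_at M u. y = induced_darts M X f x" using d by (auto simp: darts_at_def)
  qed
  have "y \<in> induced_darts M X f ` darts M" if y: "y \<in> darts X" for y
  proof -
    obtain u where "u \<in> verts M" "beg X y = f u" using im X.dartD(1)[OF y] by blast
    then have "y \<in> induced_darts M X f ` darts_at M u"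
      using bij y by (auto simp: bij_betw_def darts_at_def)
    then show ?thesis by (auto simp: darts_at_def)
  qed
  moreover have "induced_darts M X f ` darts M \<subseteq> darts X" using h(1) by (auto simp: dgraph_hom_def)
  ultimately show ?thesis using h im bij by (auto simp: covering_projection_def)
qed

end

section \<open>Automorphisms as equivariant bijections\<close>

context premaniplex_graph begin

sublocale self: two_premaniplexes n X X by unfold_locales

lemma autoD:
  assumes "a \<in> cgraph_auto X"
  shows "v \<in> verts X \<Longrightarrow> fst a v \<in> verts X" "bij_betw (fst a) (verts X) (verts X)"
    "v \<in> verts X \<Longrightarrow> i < n \<Longrightarrow> fst a (nbr X i v) = nbr X i (fst a v)"
    "x \<in> darts X \<Longrightarrow> snd a x = induced_darts X X (fst a) x"
    "x \<in> darts X \<Longrightarrow> snd a x \<in> darts X"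
    "x \<in> darts X \<Longrightarrow> beg X (snd a x) = fst a (beg X x)"
proof -
  have a: "(fst a, snd a) \<in> dgraph_hom X X" "colour_preserving X X (fst a, snd a)"
    "bij_betw (fst a) (verts X) (verts X)"
    using assms by (simp_all add: cgraph_auto_def Bij_def)
  note self.hom_nbr[OF a(1,2)]
  then show "v \<in> verts X \<Longrightarrow> fst a v \<in> verts X" "bij_betw (fst a) (verts X) (verts X)"
    "v \<in> verts X \<Longrightarrow> i < n \<Longrightarrow> fst a (nbr X i v) = nbr X i (fst a v)"
    "x \<in> darts X \<Longrightarrow> snd a x = induced_darts X X (fst a) x"
    using a(3) by blast+
  show "x \<in> darts X \<Longrightarrow> snd a x \<in> darts X" "x \<in> darts X \<Longrightarrow> beg X (snd a x) = fst a (beg X x)"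
    using a(1) by (auto simp: dgraph_hom_def)
qed

text \<open>Rigidity: the image of one vertex spreads along all walks, and tail and colour determine
  a dart. Extensionality turns agreement on the graph into equality.\<close>

lemma auto_eqI:
  assumes a: "a \<in> cgraph_auto X" and b: "b \<in> cgraph_auto X" and u: "u \<in> verts X" "fst a u = fst b u"
  shows "a = b"
proof (rule prod_eqI)
  have eq: "fst a v = fst b v" if "v \<in> verts X" for v
    by (rule vertex_induct[where Q = "\<lambda>v. fst a v = fst b v", OF u _ that])
      (simp add: autoD(3)[OF a] autoD(3)[OF b])
  then show "fst a = fst b"
    using a b by (intro extensionalityI[of _ "verts X"]) (auto simp: cgraph_auto_def Bij_def)
  show "snd a = snd b"
  proof (rule extensionalityI[of _ "darts X"])
    show "snd a x = snd b x" if "x \<in> darts X" for x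
      using autoD(4)[OF a that] autoD(4)[OF b that] eq[OF dartD(1)[OF that]] by (simp add: induced_darts_def)
  qed (use a b in \<open>auto simp: cgraph_auto_def Bij_def\<close>)
qed

lemma ex_auto:
  assumes f: "bij_betw f (verts X) (verts X)"
    "\<And>i v. v \<in> verts X \<Longrightarrow> i < n \<Longrightarrow> f (nbr X i v) = nbr X i (f v)"
  obtains a where "a \<in> cgraph_auto X" "\<And>v. v \<in> verts X \<Longrightarrow> fst a v = f v"
proof
  let ?F = "restrict f (verts X)" and ?g = "induced_darts X X f"
  let ?G = "restrict ?g (darts X)"
  have fV: "f v \<in> verts X" if "v \<in> verts X" for v using f(1) that by (auto simp: bij_betw_def)
  note h = self.induced_hom[OF fV f(2)]
  have h': "?g x \<in> darts X" "beg X (?g x) = f (beg X x)" "dinv X (?g x) = ?g (dinv X x)"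
      "colour X (?g x) = colour X x" if "x \<in> darts X" for x
    using h that by (auto simp: dgraph_hom_def colour_preserving_def)
  have "bij_betw ?g (darts X) (darts X)"
  proof (rule bij_betwI')
    fix x y assume xy: "x \<in> darts X" "y \<in> darts X"
    show "?g x = ?g y \<longleftrightarrow> x = y"
    proof
      assume eq: "?g x = ?g y"
      then have "f (beg X x) = f (beg X y)" "colour X x = colour X y" using h' xy by metis+
      then have "beg X x = beg X y" using f(1) dartD(1) xy by (auto simp: bij_betw_def inj_on_def)
      then show "x = y" using dart_of_eq xy \<open>colour X x = colour X y\<close> by metis
    qed simp
  next
    fix y assume y: "y \<in> darts X"
    have "beg X y \<in> f ` verts X" using f(1) dartD(1)[OF y] by (simp add: bij_betw_def)
    then obtain v where v: "v \<in> verts X" "f v = beg X y" by auto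
    note d = dart_of[OF v(1) dartD(4)[OF y]]
    have "y = ?g (dart_of X v (colour X y))" using d v(2) dart_of_eq[OF y] by (simp add: induced_darts_def)
    then show "\<exists>x\<in>darts X. y = ?g x" using d(1) by blast
  qed (use h' in auto)
  then have "bij_betw ?G (darts X) (darts X)" by (subst bij_betw_restrict_eq)
  moreover have "bij_betw ?F (verts X) (verts X)" using f(1) by (subst bij_betw_restrict_eq)
  ultimately show "(?F, ?G) \<in> cgraph_auto X"
    using h' fV dartD by (auto simp: cgraph_auto_def Bij_def dgraph_hom_def colour_preserving_def)
  show "fst (?F, ?G) v = f v" if "v \<in> verts X" for v using that by simp
qed

end

section \<open>The maniplex of an action\<close>

definition graph_of_action :: "nat \<Rightarrow> nat \<Rightarrow> (nat \<Rightarrow> nat \<Rightarrow> nat) \<Rightarrow> (nat, nat) cgraph" where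
  "graph_of_action n m t = \<lparr>verts = {..<m}, darts = {..<m * n}, beg = (\<lambda>x. x div n),
     dinv = (\<lambda>x. t (x mod n) (x div n) * n + x mod n), colour = (\<lambda>x. x mod n)\<rparr>"

locale maniplex_of_action =
  fixes n m :: nat and t :: "nat \<Rightarrow> nat \<Rightarrow> nat"
  assumes m: "m > 0" and act: "involutive_action n {..<m} t" and trans: "transitive_action n {..<m} t"
    and fixpoint_free: "\<And>i u. i < n \<Longrightarrow> u < m \<Longrightarrow> t i u \<noteq> u"
    and distinct: "\<And>i j u. i < n \<Longrightarrow> j < n \<Longrightarrow> i \<noteq> j \<Longrightarrow> u < m \<Longrightarrow> t i u \<noteq> t j u"
begin

abbreviation "M \<equiv> graph_of_action n m t"

lemma M_simps [simp]: "verts M = {..<m}" "darts M = {..<m * n}" "beg M = (\<lambda>x. x div n)"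
    "dinv M = (\<lambda>x. t (x mod n) (x div n) * n + x mod n)" "colour M = (\<lambda>x. x mod n)"
  by (simp_all add: graph_of_action_def)

lemma t_less: "i < n \<Longrightarrow> u < m \<Longrightarrow> t i u < m" and t_t: "i < n \<Longrightarrow> u < m \<Longrightarrow> t i (t i u) = u"
  using involutive_actionD[OF act] by auto

text \<open>The dart of colour \<open>i\<close> at \<open>u\<close> is numbered
  \<open>u * n + i\<close>, so quotient and remainder by \<open>n\<close> return its tail and its
  colour.\<close>

lemma code_less: "u < m \<Longrightarrow> i < n \<Longrightarrow> u * n + i < m * n"
proof -
  assume u: "u < m" and i: "i < n"
  have "u * n + i < Suc u * n" using i by simp
  also have "\<dots> \<le> m * n" using u by (intro mult_le_mono1) simp
  finally show ?thesis .
qed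

lemma dart_decode: "x < m * n \<Longrightarrow> x div n < m \<and> x mod n < n"
proof -
  assume x: "x < m * n"
  then have "n > 0" by (cases n) auto
  then show ?thesis using x by (simp add: less_mult_imp_div_less)
qed

lemma is_dgraph_M: "is_dgraph M"
  unfolding is_dgraph_def
proof (intro conjI ballI)
  show "verts M \<noteq> {}" using m by auto
  fix x assume "x \<in> darts M"
  then have x: "x div n < m" "x mod n < n" using dart_decode by auto
  show "beg M x \<in> verts M" "dinv M x \<in> darts M"
    using x t_less[OF x(2,1)] code_less[of "t (x mod n) (x div n)" "x mod n"] by simp_all
  have "dinv M x div n = t (x mod n) (x div n)" "dinv M x mod n = x mod n" using x(2) by simp_all
  then have "dinv M (dinv M x) = t (x mod n) (t (x mod n) (x div n)) * n + x mod n" by simp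
  then show "dinv M (dinv M x) = x" using t_t[OF x(2,1)] by simp
qed

lemma walk_iff: "walk M u xs v \<Longrightarrow> map (colour M) xs \<in> wrds n \<and> fold t (map (colour M) xs) u = v"
proof (induction xs arbitrary: u)
  case (Cons x xs)
  then have x: "x < m * n" "x div n = u" by simp_all
  then have "x mod n < n" using dart_decode by auto
  then show ?case using Cons x by simp
qed simp

lemma ex_walk_M: "w \<in> wrds n \<Longrightarrow> u < m \<Longrightarrow> \<exists>xs. walk M u xs (fold t w u)"
proof (induction w arbitrary: u)
  case (Cons i w)
  then have i: "i < n" and u: "u < m" by simp_all
  obtain xs where "walk M (t i u) xs (fold t w (t i u))"
    using Cons.IH[of "t i u"] Cons.prems t_less[OF i u] by auto
  then show ?case using i u code_less[OF u i] by (intro exI[of _ "(u * n + i) # xs"]) simp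
qed (auto intro: exI[of _ "[]"])

lemma premaniplex_M: "premaniplex n M"
  unfolding premaniplex_def
proof (intro conjI ballI allI impI)
  show "connected_dgraph M"
    unfolding connected_dgraph_def
  proof (intro conjI ballI is_dgraph_M)
    fix u v assume "u \<in> verts M" "v \<in> verts M"
    then obtain w where "w \<in> wrds n" "fold t w u = v" "u < m"
      using trans unfolding transitive_action_def by auto
    then show "\<exists>xs. walk M u xs v" using ex_walk_M by blast
  qed
  show "edge_coloured n M" using dart_decode by (auto simp: edge_coloured_def)
  show "\<exists>!x. x \<in> darts_at M v \<and> colour M x = i" if v: "v \<in> verts M" and i: "i < n" for v i
  proof (rule ex1I[of _ "v * n + i"])
    show "v * n + i \<in> darts_at M v \<and> colour M (v * n + i) = i"
      using v i code_less by (simp add: darts_at_def)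
    show "x = v * n + i" if "x \<in> darts_at M v \<and> colour M x = i" for x
      using that div_mult_mod_eq[of x n] by (simp add: darts_at_def)
  qed
  fix i j u v xs
  assume ij: "i < n" "j < n" "\<bar>int i - int j\<bar> \<ge> 2" and w: "walk M u xs v \<and> map (colour M) xs = [i, j, i, j]"
  have "xs \<noteq> []" using w by auto
  then have u: "u < m" using w dart_decode by (cases xs) auto
  have "t j (t i (t j (t i u))) = v" using walk_iff[of u xs v] w by simp
  moreover have "t j (t i (t j (t i u))) = u"
    using involutive_action_commute[OF act ij, of "t j (t i u)"] involutive_action_commute[OF act ij, of "t i u"] ij u t_less t_t
    by simp
  ultimately show "u = v" by simp
qed

lemma no_semiedges_M: "no_semiedges M"
  unfolding no_semiedges_def
proof (intro ballI notI)
  fix x assume x: "x \<in> darts M" "dinv M x = x"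
  then have "x div n < m" "x mod n < n" using dart_decode by auto
  moreover have "t (x mod n) (x div n) = dinv M x div n" using \<open>x mod n < n\<close> by simp
  ultimately show False using fixpoint_free[of "x mod n" "x div n"] unfolding x(2) by simp
qed

lemma no_parallel_edges_M: "no_parallel_edges M"
  unfolding no_parallel_edges_def
proof (intro ballI impI)
  fix x y assume xy: "x \<in> darts M" "y \<in> darts M" "beg M ` edge_of M x = beg M ` edge_of M y"
  define u i v j where uv: "u = x div n" "i = x mod n" "v = y div n" "j = y mod n"
  have x: "x = u * n + i" "u < m" "i < n" and y: "y = v * n + j" "v < m" "j < n"
    using xy dart_decode by (auto simp: uv)
  have s: "{u, t i u} = {v, t j v}"
    using xy(3) x y by (simp add: edge_of_def)
  consider "u = v" "t i u = t j v" | "u = t j v" "t i u = v"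
    using s by (auto simp: doubleton_eq_iff)
  then show "edge_of M x = edge_of M y"
  proof cases
    case 1
    then have "i = j" using distinct[OF x(3) y(3) _ x(2)] by auto
    then show ?thesis using 1 x y by simp
  next
    case 2
    then have "t i u = t j u" using t_t[OF y(3,2)] by simp
    then have "i = j" using distinct[OF x(3) y(3) _ x(2)] by auto
    then show ?thesis using 2 x y by (auto simp: edge_of_def)
  qed
qed

lemma maniplex_M: "maniplex n M"
  using premaniplex_M no_semiedges_M no_parallel_edges_M by (simp add: maniplex_iff_premaniplex)

lemma finite_M: "finite_dgraph M"
  by (simp add: finite_dgraph_def)

sublocale M: premaniplex_graph n M
  by unfold_locales (rule premaniplex_M)

lemma nbr_M: "u < m \<Longrightarrow> i < n \<Longrightarrow> nbr M i u = t i u"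
proof -
  assume u: "u < m" and i: "i < n"
  have "dart_of M u i = u * n + i"
    using M.dart_of_eq[of "u * n + i"] code_less[OF u i] i by simp
  then show ?thesis using i by (simp add: nbr_def)
qed

text \<open>An automorphism is an equivariant bijection, so it preserves the words closing at a
  vertex; conversely, equal sets of such words define one.\<close>

lemma ex_auto_iff:
  assumes "u < m" "u' < m"
  shows "(\<exists>b\<in>cgraph_auto M. fst b u = u') \<longleftrightarrow> word_stab n t u = word_stab n t u'"
proof
  assume "\<exists>b\<in>cgraph_auto M. fst b u = u'"
  then obtain b where b: "b \<in> cgraph_auto M" "fst b u = u'" by blast
  note d = M.autoD[OF b(1)]
  have eqv: "fst b (t i x) = t i (fst b x)" if "i < n" "x \<in> {..<m}" for i x
    using d(1)[of x] d(3)[of x i] nbr_M that by simp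
  have "word_stab n t (fst b u) = word_stab n t u"
  proof (rule word_stab_equivariant[OF act])
    show "inj_on (fst b) {..<m}" using d(2) by (simp add: bij_betw_def)
    show "fst b x \<in> {..<m}" if "x \<in> {..<m}" for x using d(1)[of x] that by simp
  qed (use eqv assms in auto)
  then show "word_stab n t u = word_stab n t u'" using b(2) by simp
next
  assume "word_stab n t u = word_stab n t u'"
  then obtain f where f: "bij_betw f {..<m} {..<m}" "f u = u'"
    "\<And>i x. i < n \<Longrightarrow> x \<in> {..<m} \<Longrightarrow> f (t i x) = t i (f x)"
    using equivariant_bij_if_word_stab_eq[OF act trans, of u u'] assms by auto
  have "f x < m" if "x < m" for x using f(1) that by (auto simp: bij_betw_def)
  then have fe: "f (nbr M i x) = nbr M i (f x)" if "x \<in> verts M" "i < n" for i x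
    using f(3)[OF that(2)] nbr_M that by simp
  have bf: "bij_betw f (verts M) (verts M)" using f(1) by simp
  from M.ex_auto[OF bf fe] obtain b where "b \<in> cgraph_auto M" "\<And>v. v \<in> verts M \<Longrightarrow> fst b v = f v"
    by metis
  then show "\<exists>b\<in>cgraph_auto M. fst b u = u'" using f(2) assms by auto
qed

end

text \<open>Collects all that the construction uses about \<open>G\<close>. The orbit relation is
  invariant under the colours because automorphisms preserve them, and the identity in
  \<open>G\<close> is what makes deck transformations appear among the lifts.\<close>

lemma vertex_orbits:
  assumes X: "premaniplex n X" and G: "subgroup G (AutCGraph X)"
  defines "E \<equiv> {(x, x'). x \<in> verts X \<and> (\<exists>a\<in>G. x' = fst a x)}"
  shows "equiv (verts X) E" "\<And>i x x'. i < n \<Longrightarrow> (x, x') \<in> E \<Longrightarrow> (nbr X i x, nbr X i x') \<in> E"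
    "G \<subseteq> cgraph_auto X" "(\<lambda>v\<in>verts X. v, \<lambda>x\<in>darts X. x) \<in> G"
proof -
  interpret X: premaniplex_graph n X by unfold_locales (rule X)
  interpret A: group "AutCGraph X" by (rule AutCGraph_group[OF X.is_dgraph])
  interpret G: subgroup G "AutCGraph X" by (rule G)
  show GA: "G \<subseteq> cgraph_auto X" using G.subset by (simp add: carrier_AutCGraph)
  have one: "\<one>\<^bsub>AutCGraph X\<^esub> = (\<lambda>v\<in>verts X. v, \<lambda>x\<in>darts X. x)"
    by (simp add: AutCGraph_def DirProd_def BijGroup_def)
  show "(\<lambda>v\<in>verts X. v, \<lambda>x\<in>darts X. x) \<in> G" using G.one_closed by (simp add: one)
  have mult: "fst (a \<otimes>\<^bsub>AutCGraph X\<^esub> b) x = fst a (fst b x)"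
    if "a \<in> cgraph_auto X" "b \<in> cgraph_auto X" "x \<in> verts X" for a b x
    using that by (cases a; cases b) (simp add: AutCGraph_def DirProd_def BijGroup_def cgraph_auto_def compose_def)
  have V: "fst a x \<in> verts X" if "a \<in> G" "x \<in> verts X" for a x
    using X.autoD(1) GA that by blast
  have EI: "(x, fst a x) \<in> E" if "a \<in> G" "x \<in> verts X" for a x
    using that by (auto simp: E_def)
  show "equiv (verts X) E"
  proof (rule equivI)
    show "E \<subseteq> verts X \<times> verts X" using V by (auto simp: E_def)
    show "refl_on (verts X) E"
    proof (rule refl_onI)
      fix x assume "x \<in> verts X"
      then show "(x, x) \<in> E" using EI[OF G.one_closed, of x] by (simp add: one)
    qed
    show "sym E"
    proof (rule symI)
      fix x x' assume "(x, x') \<in> E"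
      then obtain a where a: "a \<in> G" "x \<in> verts X" "x' = fst a x" by (auto simp: E_def)
      let ?b = "inv\<^bsub>AutCGraph X\<^esub> a"
      have b: "?b \<in> G" using a(1) by (rule G.m_inv_closed)
      have "?b \<otimes>\<^bsub>AutCGraph X\<^esub> a = \<one>\<^bsub>AutCGraph X\<^esub>" using a(1) by (simp add: A.l_inv)
      moreover have "?b \<in> cgraph_auto X" "a \<in> cgraph_auto X" using a b GA by blast+
      note mult[OF this a(2)]
      ultimately have "fst ?b x' = x" using a(2,3) by (simp add: one)
      then show "(x', x) \<in> E" using EI[OF b, of x'] V[OF a(1,2)] a(3) by simp
    qed
    show "trans E"
    proof (rule transI)
      fix x x' x'' assume "(x, x') \<in> E" "(x', x'') \<in> E"
      then obtain a b where ab: "a \<in> G" "b \<in> G" "x \<in> verts X" "x' = fst a x" "x'' = fst b x'"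
        by (auto simp: E_def)
      then have "fst (b \<otimes>\<^bsub>AutCGraph X\<^esub> a) x = x''" using mult[of b a x] GA by blast
      then show "(x, x'') \<in> E" using EI[OF G.m_closed[OF ab(2,1)] ab(3)] by simp
    qed
  qed
  show "(nbr X i x, nbr X i x') \<in> E" if i: "i < n" and xx': "(x, x') \<in> E" for i x x'
  proof -
    obtain a where a: "a \<in> G" "x \<in> verts X" "x' = fst a x" using xx' by (auto simp: E_def)
    have "a \<in> cgraph_auto X" using GA a(1) by blast
    then show ?thesis using EI[OF a(1) X.nbr_in[OF a(2) i]] X.autoD(3)[OF _ a(2) i] a(3) by simp
  qed
qed

theorem theorem3p4:
  fixes n :: nat
    and X :: "('v, 'd) cgraph"
    and G :: "(('v \<Rightarrow> 'v) \<times> ('d \<Rightarrow> 'd)) set"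
  assumes "n \<in> {3, 4}"
    and "premaniplex n X" and "finite_dgraph X"
    and "subgroup G (AutCGraph X)"
  shows "\<exists>(M :: (nat, nat) cgraph) (p :: (nat \<Rightarrow> 'v) \<times> (nat \<Rightarrow> 'd)).
    maniplex n M \<and> finite_dgraph M \<and> regular_covering_projection M X p \<and>
    (\<forall>a\<in>G. lifts_along M p a) \<and> lift_of M p G = carrier (AutCGraph M)"
proof -
  interpret X: premaniplex_graph n X by unfold_locales (rule assms(2))
  define E where "E = {(x, x'). x \<in> verts X \<and> (\<exists>a\<in>G. x' = fst a x)}"
  note E = vertex_orbits[OF assms(2,4), folded E_def]
  have fV: "finite (verts X)" "verts X \<noteq> {}"
    using assms(3) X.is_dgraph by (auto simp: finite_dgraph_def is_dgraph_def)
  obtain m :: nat and t \<pi> where mt: "m > 0" "involutive_action n {..<m} t" "transitive_action n {..<m} t"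
    "\<And>u. u < m \<Longrightarrow> \<pi> u \<in> verts X" "\<And>i u. i < n \<Longrightarrow> u < m \<Longrightarrow> \<pi> (t i u) = nbr X i (\<pi> u)"
    "\<And>i u. i < n \<Longrightarrow> u < m \<Longrightarrow> t i u \<noteq> u"
    "\<And>i j u. i < n \<Longrightarrow> j < n \<Longrightarrow> i \<noteq> j \<Longrightarrow> u < m \<Longrightarrow> t i u \<noteq> t j u"
    "\<And>u u'. u < m \<Longrightarrow> u' < m \<Longrightarrow> word_stab n t u = word_stab n t u' \<longleftrightarrow> (\<pi> u, \<pi> u') \<in> E"
  proof (rule covering_action[OF assms(1) X.involutive_action_nbr X.transitive_action_nbr fV E(1)])
    show "(nbr X i x, nbr X i x') \<in> E" if "i < n" "(x, x') \<in> E" for i x x'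
      using that by (rule E(2))
  qed (rule that)
  interpret maniplex_of_action n m t by unfold_locales (fact mt)+
  interpret MX: two_premaniplexes n M X by unfold_locales
  define p where "p = (\<pi>, induced_darts M X \<pi>)"
  have \<pi>: "\<pi> v \<in> verts X" "i < n \<Longrightarrow> \<pi> (nbr M i v) = nbr X i (\<pi> v)" if "v \<in> verts M" for i v
    using mt(4,5) that by (simp_all add: nbr_M)
  have cov: "covering_projection M X p"
    unfolding p_def by (rule MX.induced_covering) (use \<pi> in auto)
  then have p: "\<pi> ` verts M = verts X" "\<And>y. y \<in> darts M \<Longrightarrow> snd p y \<in> darts X"
    "\<And>y. y \<in> darts M \<Longrightarrow> beg X (snd p y) = \<pi> (beg M y)" "\<And>y. y \<in> darts M \<Longrightarrow> colour X (snd p y) = colour M y"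
    by (auto simp: covering_projection_def p_def dgraph_hom_def colour_preserving_def)
  \<comment> \<open>The set of words closing at a vertex of \<open>M\<close> mediates: on the left
    it decides equivalence under automorphisms of \<open>M\<close>, on the right it determines the
    orbit under \<open>G\<close>.\<close>
  have ex: "(\<exists>b\<in>cgraph_auto M. fst b u = u') \<longleftrightarrow> (\<exists>a\<in>G. \<pi> u' = fst a (\<pi> u))"
    if "u \<in> verts M" "u' \<in> verts M" for u u'
    using ex_auto_iff[of u u'] mt(4,8) that by (auto simp: E_def)
  \<comment> \<open>Agreement over one vertex is enough, since both composites are equivariant; the
    darts follow from their tails and colours.\<close>
  have lift: "is_lift M p a b"
    if a: "a \<in> cgraph_auto X" and b: "b \<in> cgraph_auto M" and u: "u \<in> verts M" "\<pi> (fst b u) = fst a (\<pi> u)" for a b u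
  proof -
    have v: "\<pi> (fst b v) = fst a (\<pi> v)" if "v \<in> verts M" for v
      by (rule M.vertex_induct[where Q = "\<lambda>v. \<pi> (fst b v) = fst a (\<pi> v)", OF u _ that])
        (simp only: M.autoD(1,3)[OF b] X.autoD(3)[OF a] \<pi>)
    have "snd p (snd b y) = snd a (snd p y)" if y: "y \<in> darts M" for y
    proof -
      have "colour M (snd b y) = colour M y"
        using b y by (auto simp: cgraph_auto_def colour_preserving_def)
      then show ?thesis
        using M.autoD(5,6)[OF b y] X.autoD(4)[OF a p(2)[OF y]] v[OF M.dartD(1)[OF y]] p(3,4)[OF y]
        by (simp add: p_def induced_darts_def)
    qed
    then show ?thesis using v b by (simp add: is_lift_def carrier_AutCGraph p_def)
  qed
  \<comment> \<open>Such a \<open>b\<close> is a lift of the identity and maps every fibre into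
    itself; finiteness of the fibres turns the inclusion into equality.\<close>
  have CT: "b \<in> covering_transformations M X p"
    if b: "b \<in> cgraph_auto M" and u: "u \<in> verts M" "\<pi> (fst b u) = \<pi> u" for b u
  proof -
    let ?one = "(\<lambda>v\<in>verts X. v, \<lambda>x\<in>darts X. x)"
    have l: "is_lift M p ?one b" using lift[of ?one b u] E(3,4) b u \<pi>(1) by auto
    then have v: "\<pi> (fst b v) = \<pi> v" if "v \<in> verts M" for v using that \<pi>(1) by (auto simp: is_lift_def p_def)
    have y: "snd p (snd b y) = snd p y" if "y \<in> darts M" for y using l that p(2) by (auto simp: is_lift_def)
    have "fst b ` vertex_fibre M p v = vertex_fibre M p v" for v
    proof (rule endo_inj_surj)
      show "finite (vertex_fibre M p v)" by (simp add: vertex_fibre_def)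
      show "fst b ` vertex_fibre M p v \<subseteq> vertex_fibre M p v"
        using v M.autoD(1)[OF b] by (auto simp: vertex_fibre_def p_def)
      show "inj_on (fst b) (vertex_fibre M p v)"
        by (rule inj_on_subset[of _ "verts M"]) (use b in \<open>auto simp: vertex_fibre_def cgraph_auto_def Bij_def bij_betw_def\<close>)
    qed
    moreover have "snd b ` dart_fibre M p x = dart_fibre M p x" for x
    proof (rule endo_inj_surj)
      show "finite (dart_fibre M p x)" by (simp add: dart_fibre_def)
      show "snd b ` dart_fibre M p x \<subseteq> dart_fibre M p x"
        using y M.autoD(5)[OF b] by (auto simp: dart_fibre_def)
      show "inj_on (snd b) (dart_fibre M p x)"
        by (rule inj_on_subset[of _ "darts M"]) (use b in \<open>auto simp: dart_fibre_def cgraph_auto_def Bij_def bij_betw_def\<close>)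
    qed
    ultimately show ?thesis using b by (simp add: covering_transformations_def carrier_AutCGraph)
  qed
  have CTa: "b \<in> cgraph_auto M" if "b \<in> covering_transformations M X p" for b
    using that by (simp add: covering_transformations_def carrier_AutCGraph)
  \<comment> \<open>Existence holds because two vertices with the same image lie over one orbit,
    uniqueness by rigidity.\<close>
  have vert: "\<exists>!b. b \<in> covering_transformations M X p \<and> fst b u = u'"
    if u: "u \<in> verts M" "u' \<in> verts M" "\<pi> u = \<pi> u'" for u u'
  proof -
    have "\<exists>a\<in>G. \<pi> u' = fst a (\<pi> u)" using E(4) u \<pi>(1) by force
    then obtain b where b: "b \<in> cgraph_auto M" "fst b u = u'" using ex[OF u(1,2)] by blast
    show ?thesis
    proof (rule ex1I[of _ b])
      show "b \<in> covering_transformations M X p \<and> fst b u = u'" using CT[OF b(1) u(1)] b(2) u(3) by simp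
      show "b' = b" if "b' \<in> covering_transformations M X p \<and> fst b' u = u'" for b'
        using M.auto_eqI[OF CTa b(1) u(1)] b(2) that by simp
    qed
  qed
  have reg: "regular_covering_projection M X p"
    unfolding regular_covering_projection_def
  proof (intro conjI ballI cov)
    fix v u u' assume "u \<in> vertex_fibre M p v" "u' \<in> vertex_fibre M p v"
    then show "\<exists>!b. b \<in> covering_transformations M X p \<and> fst b u = u'"
      by (intro vert) (auto simp: vertex_fibre_def p_def)
  next
    fix x y y' assume "y \<in> dart_fibre M p x" "y' \<in> dart_fibre M p x"
    then have y: "y \<in> darts M" "y' \<in> darts M" "snd p y = snd p y'" by (auto simp: dart_fibre_def)
    have c: "colour M y = colour M y'" and b: "\<pi> (beg M y) = \<pi> (beg M y')"
      using p(3,4)[OF y(1)] p(3,4)[OF y(2)] y(3) by simp_all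
    \<comment> \<open>Darts in one fibre have the same colour, so moving one to the other is the
      same as moving their tails. This reduces dart fibres to vertex fibres.\<close>
    have "snd b y = y' \<longleftrightarrow> fst b (beg M y) = beg M y'" if b: "b \<in> covering_transformations M X p" for b
    proof
      assume "snd b y = y'"
      then show "fst b (beg M y) = beg M y'" using M.autoD(6)[OF CTa[OF b] y(1)] by simp
    next
      assume "fst b (beg M y) = beg M y'"
      then show "snd b y = y'" using M.autoD(4)[OF CTa[OF b] y(1)] M.dart_of_eq[OF y(2)] c
        by (simp add: induced_darts_def)
    qed
    then show "\<exists>!b. b \<in> covering_transformations M X p \<and> snd b y = y'"
      using vert[OF M.dartD(1)[OF y(1)] M.dartD(1)[OF y(2)] b] by metis
  qed
  have lifts: "lifts_along M p a" if a: "a \<in> G" for a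
  proof -
    have aA: "a \<in> cgraph_auto X" using E(3) a by blast
    have u: "0 \<in> verts M" using mt(1) by simp
    have "fst a (\<pi> 0) \<in> \<pi> ` verts M" using X.autoD(1)[OF aA \<pi>(1)[OF u]] p(1) by simp
    then obtain u' where u': "u' \<in> verts M" "\<pi> u' = fst a (\<pi> 0)" by force
    then obtain b where b: "b \<in> cgraph_auto M" "fst b 0 = u'" using ex[OF u u'(1)] a by blast
    have "is_lift M p a b" using lift[OF aA b(1) u] b(2) u'(2) by simp
    then show ?thesis unfolding lifts_along_def by blast
  qed
  \<comment> \<open>An arbitrary automorphism is compared with \<open>G\<close> at the vertex 0
    only: the images of 0 and \<open>fst b 0\<close> lie in one orbit, and the element of
    \<open>G\<close> relating them is the one that \<open>b\<close> lifts.\<close>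
  have "b \<in> lift_of M p G" if b: "b \<in> cgraph_auto M" for b
  proof -
    have u: "0 \<in> verts M" using mt(1) by simp
    obtain a where a: "a \<in> G" "\<pi> (fst b 0) = fst a (\<pi> 0)" using ex[OF u M.autoD(1)[OF b u]] b by blast
    then show ?thesis using lift[OF _ b u a(2)] E(3) unfolding lift_of_def by blast
  qed
  then have "lift_of M p G = carrier (AutCGraph M)"
    by (auto simp: lift_of_def is_lift_def carrier_AutCGraph)
  then show ?thesis using maniplex_M finite_M reg lifts by blast
qed

end
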